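(* Let $(\Gamma,L)$ be a strongly connected $n$-dimensional periodic undirected graph, $\Phi:V_\Gamma\to L_{\mathbb R}$ a periodic realization and $x_0\in V_\Gamma$, and suppose $(\Gamma,\Phi,x_0)$ is well-arranged, witnessed by integers $d_v$ ($v\in V(P_\Gamma)$) and triangulations $T_\sigma$ ($\sigma\in\mathrm{Facet}(P_\Gamma)$). Then: (1) $i\mapsto b_{\Gamma,x_0,i}$ is a quasi-polynomial on $i\ge0$. (2) The growth series $G_{\Gamma,x_0}(t):=\sum_{i\ge0}s_{\Gamma,x_0,i}t^i$ can be written as $Q_1(t)/Q_2(t)$ with polynomials $Q_1,Q_2$ such that $Q_2(t)=\mathrm{LCM}\{\prod_{v\in V(\Delta)}(1-t^{d_v}):\sigma\in\mathrm{Facet}(P_\Gamma),\ \Delta\in T_\sigma\}$ and $\deg Q_1\le\deg Q_2$. (3) With $G_s(t):=G_{\Gamma,x_0}(t)$ and $G_b(t):=\sum_{i\ge0}b_{\Gamma,x_0,i}t^i$, one has, as rational functions, $G_b(1/t)=(-1)^{n+1}tG_b(t)$ and $G_s(1/t)=(-1)^nG_s(t)$; moreover $f_b(-i)=(-1)^nf_b(i-1)$ for all $i\in\mathbb Z$ and $f_s(-i)=(-1)^{n+1}f_s(i)$ for all $i\in\mathbb Z\setminus\{0\}$, where $f_b,f_s$ are the quasi-polynomials corresponding to $(b_{\Gamma,x_0,i})_i$ and $(s_{\Gamma,x_0,i})_i$.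
   Context: A graph $\Gamma$ is a directed graph (loops/multiple edges allowed) with source/target maps $s,t$ and weight $w:E_\Gamma\to\mathbb Z_{>0}$; undirected means there is an involution $e\mapsto e'$ of edges with $s(e)=t(e')$, $t(e)=s(e')$, $w(e)=w(e')$. Walks $p=e_1\cdots e_\ell$ satisfy $t(e_i)=s(e_{i+1})$, $w(p)=\sum w(e_i)$. A cycle is a walk with $\ell\ge1$, $s(e_1)=t(e_\ell)$, $t(e_1),\dots,t(e_\ell)$ distinct. $d_\Gamma(x,y)$ = minimum weight of a walk from $x$ to $y$; strongly connected means all finite. An $n$-dimensional periodic graph $(\Gamma,L)$: $L\cong\mathbb Z^n$ acts freely on vertices and edges with finitely many orbits, compatibly with $s,t,w$; $\Gamma/L$ is the quotient. For a cycle $q$ of $\Gamma/L$, $\mu(q):=t(\tilde q)-s(\tilde q)\in L$ for any lift $\tilde q$. $L_{\mathbb R}=L\otimes\mathbb R$; a periodic realization is $\Phi:V_\Gamma\to L_{\mathbb R}$ with $\Phi(u+x)=u+\Phi(x)$. $P_\Gamma:=\mathrm{conv}(\{\mu(q)/w(q)\}\cup\{0\})$ over cycles $q$ of $\Gamma/L$; $V(\cdot)$ and $\mathrm{Facet}(\cdot)$ denote vertex and facet sets. A triangulation of a $d$-dimensional polytope is a finite set of $d$-simplices covering it, any two meeting in a common face. $(\Gamma,\Phi,x_0)$ is well-arranged if there exist integers $d_v\in\mathbb Z_{>0}$ ($v\in V(P_\Gamma)$) and triangulations $T_\sigma$ of each facet $\sigma$ of $P_\Gamma$ such that: (1) $V(\Delta)\subset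 V(\sigma)$ for $\Delta\in T_\sigma$; (2) $d_vv\in L$; (3) for every facet $\sigma$, $\Delta\in T_\sigma$, $V'\subset V(\Delta)$, with $z:=(\sum_{v\in V'}d_vv)+x_0$, one has $d_\Gamma(x_0,y)+d_\Gamma(y,z)=\sum_{v\in V'}d_v$ for all $y\in V_\Gamma$ with $\Phi(y)-\Phi(x_0)\in\sum_{v\in V'}[0,d_v)v$. $b_{\Gamma,x_0,i}:=\#\{y:d_\Gamma(x_0,y)\le i\}$, $s_{\Gamma,x_0,i}:=\#\{y:d_\Gamma(x_0,y)=i\}$. A quasi-polynomial is $f:\mathbb Z\to\mathbb C$ such that for some $N\ge1$ and polynomials $Q_0,\dots,Q_{N-1}$, $f(m)=Q_j(m)$ whenever $m\equiv j\pmod N$; a sequence is a quasi-polynomial on $i\ge m$ if it agrees with one for all $i\ge m$. The sequences $(b_{\Gamma,x_0,i})$ and $(s_{\Gamma,x_0,i})$ are known to agree with unique quasi-polynomials $f_b,f_s$ for sufficiently large $i$. *)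

theory Defs
  imports
    "HOL-Analysis.Analysis"
    "HOL-Computational_Algebra.Computational_Algebra"
    "HOL-Computational_Algebra.Field_as_Ring"
    "HOL-Number_Theory.Cong"
    "HOL-Library.Extended_Nat"
    "Graph_Theory.Arc_Walk"
begin

text \<open>
  The group \<open>L\<close> is a full-rank lattice in the real vector space \<open>'a\<close>, which plays the role of
  \<open>L \<otimes> \<real>\<close>; every free abelian group of finite rank is of this form. The inner product of \<open>'a\<close> is
  never used. The shift functions are only meaningful for arguments in \<open>L\<close>.
\<close>

record ('v, 'e, 'a) pgraph =
  graph :: "('v, 'e) pre_digraph"
  weight :: "'e \<Rightarrow> nat"
  lat :: "'a set"
  vshift :: "'a \<Rightarrow> 'v \<Rightarrow> 'v"
  eshift :: "'a \<Rightarrow> 'e \<Rightarrow> 'e"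

definition is_full_lattice :: "nat \<Rightarrow> 'a::euclidean_space set \<Rightarrow> bool" where
  "is_full_lattice n L \<longleftrightarrow>
     (\<exists>B. independent B \<and> span B = UNIV \<and> card B = n \<and>
          L = {\<Sum>b\<in>B. real_of_int (c b) *\<^sub>R b | c. True})"

definition free_action_on :: "'a::ab_group_add set \<Rightarrow> ('a \<Rightarrow> 'x \<Rightarrow> 'x) \<Rightarrow> 'x set \<Rightarrow> bool" where
  "free_action_on L act X \<longleftrightarrow>
     (\<forall>u\<in>L. \<forall>x\<in>X. act u x \<in> X) \<and>
     (\<forall>x\<in>X. act 0 x = x) \<and>
     (\<forall>u\<in>L. \<forall>u'\<in>L. \<forall>x\<in>X. act (u + u') x = act u (act u' x)) \<and>
     (\<forall>u\<in>L. \<forall>x\<in>X. act u x = x \<longrightarrow> u = 0)"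

definition vorbit :: "('v, 'e, 'a) pgraph \<Rightarrow> 'v \<Rightarrow> 'v set" where
  "vorbit \<Gamma> x = (\<lambda>u. vshift \<Gamma> u x) ` lat \<Gamma>"

definition eorbit :: "('v, 'e, 'a) pgraph \<Rightarrow> 'e \<Rightarrow> 'e set" where
  "eorbit \<Gamma> e = (\<lambda>u. eshift \<Gamma> u e) ` lat \<Gamma>"

definition periodic_graph :: "nat \<Rightarrow> ('v, 'e, 'a::euclidean_space) pgraph \<Rightarrow> bool" where
  "periodic_graph n \<Gamma> \<longleftrightarrow>
     wf_digraph (graph \<Gamma>) \<and>
     (\<forall>e\<in>arcs (graph \<Gamma>). weight \<Gamma> e > 0) \<and>
     is_full_lattice n (lat \<Gamma>) \<and>
     free_action_on (lat \<Gamma>) (vshift \<Gamma>) (verts (graph \<Gamma>)) \<and>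
     free_action_on (lat \<Gamma>) (eshift \<Gamma>) (arcs (graph \<Gamma>)) \<and>
     (\<forall>u\<in>lat \<Gamma>. \<forall>e\<in>arcs (graph \<Gamma>).
        tail (graph \<Gamma>) (eshift \<Gamma> u e) = vshift \<Gamma> u (tail (graph \<Gamma>) e) \<and>
        head (graph \<Gamma>) (eshift \<Gamma> u e) = vshift \<Gamma> u (head (graph \<Gamma>) e) \<and>
        weight \<Gamma> (eshift \<Gamma> u e) = weight \<Gamma> e) \<and>
     finite (vorbit \<Gamma> ` verts (graph \<Gamma>)) \<and>
     finite (eorbit \<Gamma> ` arcs (graph \<Gamma>))"

definition undirected :: "('v, 'e, 'a) pgraph \<Rightarrow> bool" where
  "undirected \<Gamma> \<longleftrightarrow>
     (\<exists>rv. \<forall>e\<in>arcs (graph \<Gamma>).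
        rv e \<in> arcs (graph \<Gamma>) \<and> rv (rv e) = e \<and>
        tail (graph \<Gamma>) e = head (graph \<Gamma>) (rv e) \<and>
        head (graph \<Gamma>) e = tail (graph \<Gamma>) (rv e) \<and>
        weight \<Gamma> e = weight \<Gamma> (rv e))"

definition walk_weight :: "('e \<Rightarrow> nat) \<Rightarrow> 'e list \<Rightarrow> nat" where
  "walk_weight w p = sum_list (map w p)"

definition gdist :: "('v, 'e, 'a) pgraph \<Rightarrow> 'v \<Rightarrow> 'v \<Rightarrow> enat" where
  "gdist \<Gamma> x y =
     (INF p\<in>{p. pre_digraph.awalk (graph \<Gamma>) x p y}. enat (walk_weight (weight \<Gamma>) p))"

definition strongly_conn :: "('v, 'e, 'a) pgraph \<Rightarrow> bool" where
  "strongly_conn \<Gamma> \<longleftrightarrow> (\<forall>x\<in>verts (graph \<Gamma>). \<forall>y\<in>verts (graph \<Gamma>). gdist \<Gamma> x y \<noteq> \<infinity>)"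

text \<open>
  By equivariance the image of the orbit of an edge under the source map is exactly the orbit of
  the source (likewise for the target), and the weight is constant on orbits.
\<close>

definition quot_graph :: "('v, 'e, 'a) pgraph \<Rightarrow> ('v set, 'e set) pre_digraph" where
  "quot_graph \<Gamma> =
     \<lparr>verts = vorbit \<Gamma> ` verts (graph \<Gamma>),
      arcs = eorbit \<Gamma> ` arcs (graph \<Gamma>),
      tail = (\<lambda>E. tail (graph \<Gamma>) ` E),
      head = (\<lambda>E. head (graph \<Gamma>) ` E)\<rparr>"

definition quot_weight :: "('v, 'e, 'a) pgraph \<Rightarrow> 'e set \<Rightarrow> nat" where
  "quot_weight \<Gamma> E = the_elem (weight \<Gamma> ` E)"

text \<open>The difference \<open>t(p) - s(p)\<close> is the unique lattice element moving \<open>s(p)\<close> to \<open>t(p)\<close>.\<close>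

definition mu :: "('v, 'e, 'a) pgraph \<Rightarrow> 'e set list \<Rightarrow> 'a" where
  "mu \<Gamma> q =
     (THE u. u \<in> lat \<Gamma> \<and>
        (\<exists>x p. pre_digraph.awalk (graph \<Gamma>) x p (vshift \<Gamma> u x) \<and> map (eorbit \<Gamma>) p = q))"

definition growth_polytope :: "('v, 'e, 'a::euclidean_space) pgraph \<Rightarrow> 'a set" where
  "growth_polytope \<Gamma> =
     convex hull
       ({mu \<Gamma> q /\<^sub>R real (walk_weight (quot_weight \<Gamma>) q) | q.
           pre_digraph.cycle (quot_graph \<Gamma>) q} \<union> {0})"

definition periodic_realization ::
    "('v, 'e, 'a::euclidean_space) pgraph \<Rightarrow> ('v \<Rightarrow> 'a) \<Rightarrow> bool" where
  "periodic_realization \<Gamma> \<Phi> \<longleftrightarrow>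
     (\<forall>u\<in>lat \<Gamma>. \<forall>x\<in>verts (graph \<Gamma>). \<Phi> (vshift \<Gamma> u x) = u + \<Phi> x)"

definition vertices_of :: "'a::euclidean_space set \<Rightarrow> 'a set" where
  "vertices_of S = {v. v extreme_point_of S}"

definition triangulation_of :: "'a::euclidean_space set set \<Rightarrow> 'a set \<Rightarrow> bool" where
  "triangulation_of T S \<longleftrightarrow>
     triangulation T \<and> (\<forall>\<Delta>\<in>T. (aff_dim S) simplex \<Delta>) \<and> \<Union>T = S"

definition half_open_box :: "('a::real_vector \<Rightarrow> nat) \<Rightarrow> 'a set \<Rightarrow> 'a set" where
  "half_open_box d V = {\<Sum>v\<in>V. c v *\<^sub>R v | c. \<forall>v\<in>V. 0 \<le> c v \<and> c v < real (d v)}"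

definition well_arranged_by ::
    "('v, 'e, 'a::euclidean_space) pgraph \<Rightarrow> ('v \<Rightarrow> 'a) \<Rightarrow> 'v \<Rightarrow>
     ('a \<Rightarrow> nat) \<Rightarrow> ('a set \<Rightarrow> 'a set set) \<Rightarrow> bool" where
  "well_arranged_by \<Gamma> \<Phi> x0 d T \<longleftrightarrow>
     (\<forall>v\<in>vertices_of (growth_polytope \<Gamma>). d v > 0) \<and>
     (\<forall>\<sigma>. \<sigma> facet_of growth_polytope \<Gamma> \<longrightarrow> triangulation_of (T \<sigma>) \<sigma>) \<and>
     (\<forall>\<sigma>. \<sigma> facet_of growth_polytope \<Gamma> \<longrightarrow> (\<forall>\<Delta>\<in>T \<sigma>. vertices_of \<Delta> \<subseteq> vertices_of \<sigma>)) \<and>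
     (\<forall>v\<in>vertices_of (growth_polytope \<Gamma>). real (d v) *\<^sub>R v \<in> lat \<Gamma>) \<and>
     (\<forall>\<sigma>. \<sigma> facet_of growth_polytope \<Gamma> \<longrightarrow>
        (\<forall>\<Delta>\<in>T \<sigma>. \<forall>V'. V' \<subseteq> vertices_of \<Delta> \<longrightarrow>
           (let z = vshift \<Gamma> (\<Sum>v\<in>V'. real (d v) *\<^sub>R v) x0 in
            \<forall>y\<in>verts (graph \<Gamma>). \<Phi> y - \<Phi> x0 \<in> half_open_box d V' \<longrightarrow>
              gdist \<Gamma> x0 y + gdist \<Gamma> y z = enat (\<Sum>v\<in>V'. d v))))"

definition ball_count :: "('v, 'e, 'a) pgraph \<Rightarrow> 'v \<Rightarrow> nat \<Rightarrow> nat" where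
  "ball_count \<Gamma> x0 i = card {y \<in> verts (graph \<Gamma>). gdist \<Gamma> x0 y \<le> enat i}"

definition sphere_count :: "('v, 'e, 'a) pgraph \<Rightarrow> 'v \<Rightarrow> nat \<Rightarrow> nat" where
  "sphere_count \<Gamma> x0 i = card {y \<in> verts (graph \<Gamma>). gdist \<Gamma> x0 y = enat i}"

definition quasi_polynomial :: "(int \<Rightarrow> complex) \<Rightarrow> bool" where
  "quasi_polynomial f \<longleftrightarrow>
     (\<exists>N::nat. N \<ge> 1 \<and> (\<exists>Q :: nat \<Rightarrow> complex poly.
        \<forall>j<N. \<forall>m. [m = int j] (mod int N) \<longrightarrow> f m = poly (Q j) (of_int m)))"

definition quasi_polynomial_on_ge :: "nat \<Rightarrow> (nat \<Rightarrow> nat) \<Rightarrow> bool" where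
  "quasi_polynomial_on_ge m a \<longleftrightarrow>
     (\<exists>f. quasi_polynomial f \<and> (\<forall>i\<ge>m. of_nat (a i) = f (int i)))"

definition corresponding_quasi_polynomial :: "(nat \<Rightarrow> nat) \<Rightarrow> (int \<Rightarrow> complex) \<Rightarrow> bool" where
  "corresponding_quasi_polynomial a f \<longleftrightarrow>
     quasi_polynomial f \<and> (\<exists>m. \<forall>i\<ge>m. of_nat (a i) = f (int i))"

definition gen_series :: "(nat \<Rightarrow> nat) \<Rightarrow> complex fps" where
  "gen_series a = Abs_fps (\<lambda>i. of_nat (a i))"

text \<open>Rational functions in one variable \<open>t\<close> are elements of the field \<open>complex poly fract\<close>.\<close>

definition has_power_series :: "complex poly fract \<Rightarrow> complex fps \<Rightarrow> bool" where
  "has_power_series R F \<longleftrightarrow>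
     (\<exists>p q. q \<noteq> 0 \<and> R = Fract p q \<and> F * fps_of_poly q = fps_of_poly p)"

definition ratfun_var :: "complex poly fract" where
  "ratfun_var = to_fract [:0, 1:]"

definition poly_subst :: "complex poly \<Rightarrow> complex poly fract \<Rightarrow> complex poly fract" where
  "poly_subst p S = poly (map_poly (\<lambda>c. to_fract [:c:]) p) S"

text \<open>
  \<open>R(S(t))\<close>, computed from the reduced fraction of \<open>R\<close>; used below with \<open>S = 1/t\<close>, where the
  denominator does not vanish and every fraction representing \<open>R\<close> gives the same result.
\<close>

definition ratfun_subst :: "complex poly fract \<Rightarrow> complex poly fract \<Rightarrow> complex poly fract" where
  "ratfun_subst R S = (case quot_of_fract R of (p, q) \<Rightarrow> poly_subst p S / poly_subst q S)"

text \<open>\<open>Lcm\<close> on polynomials over a field is the monic representative of the least common multiple.\<close>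

definition growth_denominator ::
    "('v, 'e, 'a::euclidean_space) pgraph \<Rightarrow> ('a \<Rightarrow> nat) \<Rightarrow> ('a set \<Rightarrow> 'a set set) \<Rightarrow> complex poly"
  where
  "growth_denominator \<Gamma> d T =
     Lcm {\<Prod>v\<in>vertices_of \<Delta>. 1 - monom 1 (d v) | \<sigma> \<Delta>.
            \<sigma> facet_of growth_polytope \<Gamma> \<and> \<Delta> \<in> T \<sigma>}"

end

theory Submission
  imports Defs
begin

text \<open>
  Coning the simplices of the triangulations from the origin, which is interior to the growth
  polytope, gives finitely many simplicial cones with disjoint interiors covering the space; the
  triangulations of adjacent facets need not match along common ridges. A generic vector \<open>\<xi>\<close> decides
  for each facet of each cone whether to keep it, and the resulting half-open cones form an exact
  partition, as do the opposite ones obtained from \<open>-\<xi>\<close>.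

  Decomposing closed walks of the quotient into cycles bounds the distance to a lattice translate
  from below by the gauge of the polytope. With well-arrangedness this shows that translating a
  vertex by \<open>d v *\<^sub>R v\<close> inside a cone through \<open>v\<close>, or inside its negative, increases the distance from
  \<open>x0\<close> by exactly \<open>d v\<close>, so the vertices over a half-open cone have a generating function with
  denominator \<open>\<Prod>(1 - t ^ d v)\<close> and numerator counting a fundamental box. The point reflection of a box
  exchanges the half-open cones of \<open>\<xi>\<close> with the negatives of those of \<open>-\<xi>\<close> and turns a distance into
  the total side length minus the distance; summed over all cones this makes the numerator
  palindromic, which is the reciprocity law.
\<close>

text \<open>The graph need not admit a point reflection. The reflection of a box with corner sum S
  is therefore realised as the translation of vertices by -S, which lands in the negative cone; this
  is why negatives of cones occur at all. Undirectedness enters only through the symmetry of the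
  distance: it turns the way from y to the far corner of the box into the distance from x0 to y - S.
  The palindrome itself comes from comparing two expansions. Both families of half-open cones cover
  all vertices, so over a common denominator their numerators coincide, while the reflection makes
  each the reverse of the other. Two sizes of boxes are used. Sides \<open>d v\<close> give each
  cell its own denominator and lead to the least common multiple. A common side \<open>N\<close>
  gives the single denominator (1 - t^N)^n and the same formal degree n * N for every cell. The
  numerator of the sphere series may have the degree of its denominator, so the spheres may deviate
  from their quasi-polynomial at i = 0. The ball series is proper, so the quasi-polynomials are
  obtained for balls, and for spheres by taking differences.\<close>

unbundle no vec_syntax

section \<open>Quasi-polynomials from rational series\<close>

text \<open>On the progression \<open>z + k * (N * N')\<close> each function is given by a single
  polynomial, and two polynomials that agree at infinitely many points are equal.\<close>

lemma quasi_polynomial_eqI: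
  assumes "quasi_polynomial f" "quasi_polynomial g"
    and eq: "\<And>i::nat. i \<ge> m \<Longrightarrow> f (int i) = g (int i)"
  shows "f = g"
proof
  fix z :: int
  obtain N Q where N: "N \<ge> (1::nat)" and Q: "\<And>j m. j < N \<Longrightarrow> [m = int j] (mod int N) \<Longrightarrow> f m = poly (Q j) (of_int m)"
    using assms(1) unfolding quasi_polynomial_def by blast
  obtain N' Q' where N': "N' \<ge> (1::nat)" and Q': "\<And>j m. j < N' \<Longrightarrow> [m = int j] (mod int N') \<Longrightarrow> g m = poly (Q' j) (of_int m)"
    using assms(2) unfolding quasi_polynomial_def by blast
  define j where "j = nat (z mod int N)"
  define j' where "j' = nat (z mod int N')"
  have j: "j < N" "int j = z mod int N" using N by (auto simp: j_def nat_less_iff)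
  have j': "j' < N'" "int j' = z mod int N'" using N' by (auto simp: j'_def nat_less_iff)
  have f: "f (z + k * (int N * int N')) = poly (Q j) (of_int (z + k * (int N * int N')))" for k
    by (rule Q) (use j in \<open>auto simp: cong_def mult.left_commute[of _ "int N"]\<close>)
  have g: "g (z + k * (int N * int N')) = poly (Q' j') (of_int (z + k * (int N * int N')))" for k
    by (rule Q') (use j' in \<open>auto simp: cong_def mult.assoc[symmetric]\<close>)
  define h where "h k = z + int k * (int N * int N')" for k
  \<comment> \<open>The step of the progression is at least 1, so from index \<open>K\<close> on it
    lies beyond \<open>m\<close>.\<close>
  define K where "K = nat (int m - z)"
  have NN: "int N * int N' \<ge> 1" using N N' mult_mono[of 1 "int N" 1 "int N'"] by simp
  have root: "poly (Q j - Q' j') (of_int (h k)) = 0" if "k \<ge> K" for k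
  proof -
    have "int k * (int N * int N') \<ge> int k * 1"
      by (rule mult_left_mono[OF NN]) simp
    then have "h k \<ge> int m" using that unfolding h_def K_def by linarith
    then have "f (h k) = g (h k)" using eq[of "nat (h k)"] by auto
    then show ?thesis using f[of "int k"] g[of "int k"] by (simp add: h_def)
  qed
  have "inj_on (\<lambda>k. of_int (h k) :: complex) {K..}"
    using N N' by (auto simp: inj_on_def h_def)
  then have "infinite ((\<lambda>k. of_int (h k) :: complex) ` {K..})"
    using finite_imageD infinite_Ici by blast
  moreover have "(\<lambda>k. of_int (h k)) ` {K..} \<subseteq> {x. poly (Q j - Q' j') x = 0}"
    using root by auto
  ultimately have "Q j - Q' j' = 0"
    using poly_roots_finite finite_subset by blast
  then show "f z = g z" using f[of 0] g[of 0] by simp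
qed

text \<open>The power series of 1 / (1 - t^N)^(m + 1).\<close>

definition binom_series :: "nat \<Rightarrow> nat \<Rightarrow> complex fps" where
  "binom_series N m = Abs_fps (\<lambda>i. if N dvd i then of_nat (i div N + m choose m) else 0)"

lemma fps_mult_one_minus_X_power_nth:
  fixes F :: "'a::comm_ring_1 fps"
  shows "(F * (1 - fps_X ^ e)) $ i = F $ i - (if i < e then 0 else F $ (i - e))"
  by (simp add: right_diff_distrib fps_X_power_mult_right_nth)

text \<open>Pascal's rule at the multiples of \<open>N\<close>.\<close>

lemma binom_series_Suc:
  assumes "N \<ge> 1"
  shows "binom_series N (Suc m) * (1 - fps_X ^ N) = binom_series N m"
proof (rule fps_ext)
  fix i
  show "(binom_series N (Suc m) * (1 - fps_X ^ N)) $ i = binom_series N m $ i"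
  proof (cases "N dvd i")
    case True
    then obtain q where q: "i = N * q" by blast
    then show ?thesis
      using assms by (cases q) (auto simp: fps_mult_one_minus_X_power_nth binom_series_def)
  next
    case False
    then have "\<not> N dvd i - N" if "i \<ge> N" using that by (simp add: dvd_minus_self)
    then show ?thesis using False by (auto simp: fps_mult_one_minus_X_power_nth binom_series_def)
  qed
qed

lemma binom_series_0:
  assumes "N \<ge> 1"
  shows "binom_series N 0 * (1 - fps_X ^ N) = 1"
proof (rule fps_ext)
  fix i
  show "(binom_series N 0 * (1 - fps_X ^ N)) $ i = (1 :: complex fps) $ i"
    using assms by (auto simp: fps_mult_one_minus_X_power_nth binom_series_def dvd_minus_self dest: dvd_imp_le)
qed

lemma binom_series_inverse:
  assumes "N \<ge> 1"
  shows "binom_series N m * (1 - fps_X ^ N) ^ Suc m = 1"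
proof (induction m)
  case 0
  then show ?case using binom_series_0[OF assms] by simp
next
  case (Suc m)
  have "binom_series N (Suc m) * (1 - fps_X ^ N) ^ Suc (Suc m)
      = (binom_series N (Suc m) * (1 - fps_X ^ N)) * (1 - fps_X ^ N) ^ Suc m"
    by (simp add: mult.assoc)
  also have "\<dots> = 1" unfolding binom_series_Suc[OF assms] by (rule Suc)
  finally show ?case .
qed

text \<open>For \<open>P\<close> of degree below \<open>Suc n * N\<close> these are the coefficients
  of P / (1 - t^N)^(n + 1), continued to all integers: the condition k \<le> i of the convolution is
  dropped, and \<open>gchoose\<close> admits negative upper arguments.\<close>

definition expansion_quasi_poly :: "nat \<Rightarrow> nat \<Rightarrow> complex poly \<Rightarrow> int \<Rightarrow> complex" where
  "expansion_quasi_poly N n P i = (\<Sum>k<Suc n * N.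
     if int N dvd i - int k
     then coeff P k * ((of_int ((i - int k) div int N) + of_nat n) gchoose n) else 0)"

text \<open>On a residue class modulo \<open>N\<close> the divisibility of i - k does not depend on
  i, and where it holds the integer division is exact, hence affine in i.\<close>

lemma quasi_polynomial_expansion:
  assumes "N \<ge> 1"
  shows "quasi_polynomial (expansion_quasi_poly N n P)"
proof -
  define B :: "complex poly" where
    "B = smult (1 / fact n) (\<Prod>i = 0..<n. [:of_nat n - of_nat i, 1:])"
  have B: "poly B x = (x + of_nat n) gchoose n" for x
    by (simp add: B_def gbinomial_prod_rev poly_prod algebra_simps)
  define Q where "Q j = (\<Sum>k<Suc n * N. if int N dvd int j - int k
     then smult (coeff P k) (pcompose B [:- of_nat k / of_nat N, 1 / of_nat N:]) else 0)" for j :: nat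
  have "expansion_quasi_poly N n P m = poly (Q j) (of_int m)" if m: "[m = int j] (mod int N)" for j m
    unfolding expansion_quasi_poly_def Q_def poly_sum
  proof (rule sum.cong)
    fix k
    have "[m - int k = int j - int k] (mod int N)" using m by (simp add: cong_diff)
    then have dvd: "int N dvd m - int k \<longleftrightarrow> int N dvd int j - int k"
      by (metis cong_dvd_modulus cong_0_iff cong_trans cong_sym)
    show "(if int N dvd m - int k then coeff P k * ((of_int ((m - int k) div int N) + of_nat n) gchoose n) else 0)
      = poly (if int N dvd int j - int k
          then smult (coeff P k) (pcompose B [:- of_nat k / of_nat N, 1 / of_nat N:]) else 0) (of_int m)"
    proof (cases "int N dvd m - int k")
      case True
      have "(of_int ((m - int k) div int N) :: complex) = of_int (m - int k) / of_int (int N)"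
        using True by (rule of_int_div)
      also have "\<dots> = - of_nat k / of_nat N + of_int m * (1 / of_nat N)"
        by (simp add: diff_divide_distrib)
      finally show ?thesis using True dvd by (simp add: poly_pcompose B)
    next
      case False
      then show ?thesis using dvd by simp
    qed
  qed simp
  then show ?thesis unfolding quasi_polynomial_def using assms by blast
qed

text \<open>The degree bound removes all k \<ge> (n + 1) * N from the convolution. Conversely, a
  surplus term of the expansion has i < k < (n + 1) * N, so q = (i - k) / N is one of -n, ..., -1,
  and (q + n) choose n vanishes there. Hence the formula is valid from i = 0 on.\<close>

lemma expansion_quasi_poly_nth:
  assumes N: "N \<ge> 1" and deg: "degree P < Suc n * N"
    and F: "F * fps_of_poly ((1 - monom 1 N) ^ Suc n) = fps_of_poly P"
  shows "F $ i = expansion_quasi_poly N n P (int i)"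
proof -
  have "F = F * (1 - fps_X ^ N) ^ Suc n * binom_series N n"
    using binom_series_inverse[OF N, of n] by (simp add: mult.assoc mult.commute)
  also have "\<dots> = fps_of_poly P * binom_series N n"
    using F by (simp only: fps_of_poly_power fps_of_poly_diff fps_of_poly_monom fps_of_poly_1 fps_const_1_eq_1 mult_1_left)
  finally have "F $ i = (\<Sum>k=0..i. coeff P k * binom_series N n $ (i - k))"
    by (simp add: fps_mult_nth)
  also have "\<dots> = (\<Sum>k\<in>{0..i} \<inter> {..<Suc n * N}. coeff P k * binom_series N n $ (i - k))"
    by (rule sum.mono_neutral_right) (use deg in \<open>auto intro!: coeff_eq_0\<close>)
  also have "\<dots> = (\<Sum>k\<in>{0..i} \<inter> {..<Suc n * N}. 
     if int N dvd int i - int k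
     then coeff P k * ((of_int ((int i - int k) div int N) + of_nat n) gchoose n) else 0)"
  proof (rule sum.cong)
    fix k assume "k \<in> {0..i} \<inter> {..<Suc n * N}"
    then have ik: "int i - int k = int (i - k)" by auto
    show "coeff P k * binom_series N n $ (i - k) = (if int N dvd int i - int k
     then coeff P k * ((of_int ((int i - int k) div int N) + of_nat n) gchoose n) else 0)"
      unfolding ik binom_series_def
      by (simp flip: of_nat_add zdiv_int add: binomial_gbinomial)
  qed simp
  also have "\<dots> = expansion_quasi_poly N n P (int i)"
    unfolding expansion_quasi_poly_def
  proof (rule sum.mono_neutral_left)
    show "\<forall>k\<in>{..<Suc n * N} - {0..i} \<inter> {..<Suc n * N}. (if int N dvd int i - int k
     then coeff P k * ((of_int ((int i - int k) div int N) + of_nat n :: complex) gchoose n) else 0) = 0"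
    proof
      fix k assume k: "k \<in> {..<Suc n * N} - {0..i} \<inter> {..<Suc n * N}"
      show "(if int N dvd int i - int k
        then coeff P k * ((of_int ((int i - int k) div int N) + of_nat n :: complex) gchoose n) else 0) = 0"
      proof (cases "int N dvd int i - int k")
        case True
        then obtain q where q: "int i - int k = int N * q" by blast
        have "int N * q < 0" using q k by auto
        then have q0: "q < 0" using N by (auto simp: mult_less_0_iff)
        have "int k < int (Suc n) * int N" using k by (metis DiffD1 lessThan_iff of_nat_less_iff of_nat_mult)
        then have "int N * q > - (int (Suc n) * int N)" using q by linarith
        then have "int N * (q + int (Suc n)) > 0" by (simp add: algebra_simps)
        then have qn: "q + int (Suc n) > 0" using N by (auto simp: zero_less_mult_iff)
        have "(of_int q + of_nat n :: complex) = of_nat (nat (q + int n))"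
          using qn of_nat_nat[of "q + int n", where 'a = complex] by simp
        moreover have "nat (q + int n) < n" using q0 qn by auto
        ultimately have "(of_int q + of_nat n :: complex) gchoose n = 0"
          by (simp flip: binomial_gbinomial)
        then show ?thesis using q N by simp
      qed simp
    qed
  qed auto
  finally show ?thesis .
qed

text \<open>Reversing the sum, k to (n + 1) * N - 1 - k, turns the quotient q = (-i - k) / N into -q
  - (n + 1), and upper negation gives (q + n) choose n = (-1)^n * ((-q - 1) choose n). The shift
  from i to i - 1 balances the -1 in the formal degree of \<open>P\<close>.\<close>

lemma expansion_quasi_poly_reflect:
  assumes N: "N \<ge> 1"
    and pal: "\<And>k. k < Suc n * N \<Longrightarrow> coeff P (Suc n * N - 1 - k) = coeff P k"
  shows "expansion_quasi_poly N n P (- i) = (- 1) ^ n * expansion_quasi_poly N n P (i - 1)"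
proof -
  let ?M = "Suc n * N"
  have "expansion_quasi_poly N n P (i - 1) = (\<Sum>k<?M.
     if int N dvd i - 1 - int (?M - Suc k)
     then coeff P (?M - Suc k) * ((of_int ((i - 1 - int (?M - Suc k)) div int N) + of_nat n) gchoose n) else 0)"
    unfolding expansion_quasi_poly_def
    by (rule sum.nat_diff_reindex[symmetric])
  also have "(- 1) ^ n * \<dots> = expansion_quasi_poly N n P (- i)"
    unfolding expansion_quasi_poly_def sum_distrib_left
  proof (rule sum.cong)
    fix k assume "k \<in> {..<?M}"
    then have k: "k < ?M" by simp
    have e: "i - 1 - int (?M - Suc k) = - (- i - int k) + int N * (- int (Suc n))"
      using k by (simp add: of_nat_diff algebra_simps)
    have dvd: "int N dvd - (- i - int k) + int N * (- int (Suc n)) \<longleftrightarrow> int N dvd (- i - int k)"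
      by (metis dvd_add_left_iff dvd_minus_iff dvd_triv_left)
    show "(- 1) ^ n * (if int N dvd i - 1 - int (?M - Suc k)
       then coeff P (?M - Suc k) * ((of_int ((i - 1 - int (?M - Suc k)) div int N) + of_nat n) gchoose n) else 0)
      = (if int N dvd - i - int k
       then coeff P k * ((of_int ((- i - int k) div int N) + of_nat n) gchoose n) else 0)"
    proof (cases "int N dvd - i - int k")
      case True
      then obtain q where q: "- i - int k = int N * q" by blast
      have "- (- i - int k) + int N * (- int (Suc n)) = int N * (- q - int (Suc n))"
        unfolding q by (simp add: algebra_simps)
      then have dv: "(- (- i - int k) + int N * (- int (Suc n))) div int N = - q - int (Suc n)"
        using N by simp
      have dv': "(- i - int k) div int N = q"
        using q N by simp
      have gb: "(of_int q + of_nat n :: complex) gchoose n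
          = (- 1) ^ n * ((of_int (- q - int (Suc n)) + of_nat n) gchoose n)"
        by (subst gbinomial_negated_upper) (simp add: algebra_simps)
      show ?thesis unfolding e dvd dv dv' gb using True pal[OF k] by simp
    next
      case False
      then show ?thesis unfolding e dvd by simp
    qed
  qed simp
  finally show ?thesis by simp
qed

section \<open>Substituting the inverse variable in a rational function\<close>

lemma poly_subst_0 [simp]: "poly_subst 0 S = 0"
  by (simp add: poly_subst_def)

lemma poly_subst_pCons [simp]:
  "poly_subst (pCons a p) S = to_fract [:a:] + S * poly_subst p S"
  by (simp add: poly_subst_def map_poly_pCons)

lemma poly_subst_add: "poly_subst (p + q) S = poly_subst p S + poly_subst q S"
proof (induction p q rule: poly_induct2)
  case (pCons a p b q)
  have "to_fract [:a + b:] = to_fract [:a:] + to_fract [:b:]" by (simp flip: to_fract_add)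
  then show ?case using pCons by (simp add: algebra_simps)
qed simp

lemma poly_subst_smult: "poly_subst (smult c p) S = to_fract [:c:] * poly_subst p S"
proof (induction p)
  case (pCons a p)
  have "to_fract [:c * a:] = to_fract [:c:] * to_fract [:a:]" by (simp flip: to_fract_mult)
  then show ?case using pCons by (simp add: algebra_simps)
qed simp

lemma poly_subst_mult: "poly_subst (p * q) S = poly_subst p S * poly_subst q S"
proof (induction p)
  case (pCons a p)
  then show ?case by (simp add: poly_subst_add poly_subst_smult algebra_simps)
qed simp

lemma poly_subst_1 [simp]: "poly_subst 1 S = 1"
  using poly_subst_pCons[of 1 0 S] by (simp flip: one_pCons)

lemma poly_subst_power: "poly_subst (p ^ k) S = poly_subst p S ^ k"
  by (induction k) (simp_all add: poly_subst_mult)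

lemma poly_subst_monom: "poly_subst (monom c k) S = to_fract [:c:] * S ^ k"
  by (induction k) (simp_all add: monom_0 monom_Suc algebra_simps)

lemma poly_subst_sum: "poly_subst (sum f A) S = (\<Sum>a\<in>A. poly_subst (f a) S)"
  by (induction A rule: infinite_finite_induct) (simp_all add: poly_subst_add)

lemma ratfun_var_nonzero [simp]: "ratfun_var \<noteq> 0"
  by (simp add: ratfun_var_def)

lemma to_fract_power: "to_fract (p ^ k) = to_fract p ^ k"
  by (induction k) simp_all

lemma to_fract_monom: "to_fract (monom c k) = to_fract [:c:] * ratfun_var ^ k"
  unfolding ratfun_var_def
  by (induction k) (simp_all add: monom_0 monom_Suc mult.left_commute flip: to_fract_mult to_fract_power)

text \<open>Inverting t and clearing denominators reverses the coefficients. The formal degree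
  \<open>m\<close> may exceed the true one, since palindromes are stated with respect to a formal
  degree.\<close>

lemma poly_subst_inverse_var:
  assumes "degree p \<le> m"
  shows "ratfun_var ^ m * poly_subst p (1 / ratfun_var)
       = to_fract (\<Sum>k\<le>m. monom (coeff p (m - k)) k)"
proof -
  have "poly_subst p (1 / ratfun_var) = (\<Sum>k\<le>m. poly_subst (monom (coeff p k) k) (1 / ratfun_var))"
    by (subst (1) poly_as_sum_of_monoms'[OF assms, symmetric]) (rule poly_subst_sum)
  also have "ratfun_var ^ m * \<dots> = (\<Sum>k\<le>m. to_fract (monom (coeff p k) (m - k)))"
    unfolding sum_distrib_left
  proof (rule sum.cong)
    fix k assume "k \<in> {..m}"
    then have "ratfun_var ^ m = ratfun_var ^ (m - k) * ratfun_var ^ k"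
      by (simp flip: power_add)
    then show "ratfun_var ^ m * poly_subst (monom (coeff p k) k) (1 / ratfun_var) = to_fract (monom (coeff p k) (m - k))"
      by (simp add: poly_subst_monom to_fract_monom power_one_over)
  qed simp
  also have "\<dots> = (\<Sum>k\<le>m. to_fract (monom (coeff p (m - k)) k))"
    by (rule sum.reindex_bij_witness[of _ "\<lambda>k. m - k" "\<lambda>k. m - k"]) auto
  finally show ?thesis by simp
qed

text \<open>The constant coefficient of the reversed polynomial is the leading coefficient of
  \<open>p\<close>.\<close>

lemma poly_subst_inverse_var_nonzero:
  assumes "p \<noteq> 0"
  shows "poly_subst p (1 / ratfun_var) \<noteq> 0"
proof
  assume "poly_subst p (1 / ratfun_var) = 0"
  then have "to_fract (\<Sum>k\<le>degree p. monom (coeff p (degree p - k)) k) = 0"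
    using poly_subst_inverse_var[OF order.refl, of p] by simp
  then have "coeff (\<Sum>k\<le>degree p. monom (coeff p (degree p - k)) k) 0 = 0"
    unfolding to_fract_eq_0_iff by simp
  then show False using assms by (simp add: coeff_sum sum.delta)
qed

text \<open>Substitution is multiplicative on polynomials, so it respects the cross-multiplied
  equality between \<open>Fract p q\<close> and its reduced form.\<close>

lemma ratfun_subst_Fract:
  assumes "q \<noteq> 0"
  shows "ratfun_subst (Fract p q) (1 / ratfun_var)
       = poly_subst p (1 / ratfun_var) / poly_subst q (1 / ratfun_var)"
proof -
  obtain p' q' where pq: "quot_of_fract (Fract p q) = (p', q')" by fastforce
  have q': "q' \<noteq> 0" using snd_quot_of_fract_nonzero[of "Fract p q"] pq by simp
  have "Fract p' q' = Fract p q" using Fract_quot_of_fract[of "Fract p q"] pq by simp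
  then have "p' * q = p * q'" using assms q' by (simp add: eq_fract)
  then have "poly_subst p' (1 / ratfun_var) * poly_subst q (1 / ratfun_var)
      = poly_subst p (1 / ratfun_var) * poly_subst q' (1 / ratfun_var)"
    by (simp flip: poly_subst_mult)
  then show ?thesis
    using poly_subst_inverse_var_nonzero[OF assms] poly_subst_inverse_var_nonzero[OF q']
    by (simp add: ratfun_subst_def pq field_simps)
qed

lemma one_minus_monom_nonzero:
  assumes "N \<ge> 1"
  shows "1 - monom 1 N \<noteq> (0 :: 'a::comm_ring_1 poly)"
proof
  assume "1 - monom 1 N = (0 :: 'a poly)"
  then have "coeff (1 - monom 1 N :: 'a poly) 0 = 0" by simp
  then show False using assms by simp
qed

text \<open>The numerator contributes t^(-m) and each factor 1 - t^N of the denominator contributes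
  -t^(-N). The spare exponent \<open>r * N - m\<close> will be 1 for balls and 0 for
  spheres.\<close>

lemma ratfun_subst_palindromic:
  assumes N: "N \<ge> 1" and deg: "degree P \<le> m" and m: "m \<le> r * N"
    and pal: "\<And>k. k \<le> m \<Longrightarrow> coeff P (m - k) = coeff P k"
  shows "ratfun_subst (Fract P ((1 - monom 1 N) ^ r)) (1 / ratfun_var)
       = (- 1) ^ r * ratfun_var ^ (r * N - m) * Fract P ((1 - monom 1 N) ^ r)"
proof -
  let ?t = ratfun_var
  define Q :: "complex poly" where "Q = (1 - monom 1 N) ^ r"
  have Q: "Q \<noteq> 0" unfolding Q_def by (rule power_not_zero[OF one_minus_monom_nonzero[OF N]])
  have "(\<Sum>k\<le>m. monom (coeff P (m - k)) k) = (\<Sum>k\<le>m. monom (coeff P k) k)"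
    using pal by simp
  then have P: "?t ^ m * poly_subst P (1 / ?t) = to_fract P"
    using poly_subst_inverse_var[OF deg] poly_as_sum_of_monoms'[OF deg] by simp
  have "poly_subst (1 - monom 1 N) (1 / ?t) = poly_subst (1 + monom (- 1) N) (1 / ?t)"
    by (simp flip: minus_monom)
  also have "\<dots> = 1 - (1 / ?t) ^ N"
  proof -
    have "[:- 1:] = (- 1 :: complex poly)" by (simp add: one_pCons)
    then show ?thesis by (simp add: poly_subst_add poly_subst_monom)
  qed
  also have "\<dots> = (- 1) * (1 - ?t ^ N) / ?t ^ N"
    by (simp add: power_one_over field_simps)
  also have "1 - ?t ^ N = to_fract (1 - monom 1 N)"
    by (simp add: to_fract_monom flip: one_pCons)
  finally have Qs: "poly_subst Q (1 / ?t) = (- 1) ^ r * to_fract Q / (?t ^ (r * N - m) * ?t ^ m)"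
    using m unfolding Q_def poly_subst_power
    by (simp add: power_mult_distrib power_divide to_fract_power mult.commute[of r]
        flip: power_minus power_mult power_add)
  have Ps: "poly_subst P (1 / ?t) = to_fract P / ?t ^ m"
    using P by (simp add: field_simps)
  have cancel: "p / x / (e * q / (c * x)) = e * c * (p / q)"
    if "x \<noteq> 0" "q \<noteq> 0" "c \<noteq> 0" "e * e = 1" for p q x c e :: "complex poly fract"
  proof -
    have "e * c * (p / q) * (e * q / (c * x)) = (e * e) * (p / x)"
      using that by (simp add: field_simps)
    then have eq: "p / x = e * c * (p / q) * (e * q / (c * x))" using that(4) by simp
    have "e * q / (c * x) \<noteq> 0" using that by auto
    then show ?thesis using eq by (rule iffD2[OF nonzero_divide_eq_eq])
  qed
  have "(- 1) ^ r * (- 1) ^ r = (1 :: complex poly fract)"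
    by (simp flip: power_mult_distrib)
  then show ?thesis
    unfolding Q_def[symmetric] ratfun_subst_Fract[OF Q] Ps Qs
    unfolding Fract_conv_to_fract[of P Q]
    by (intro cancel) (use Q in simp_all)
qed

text \<open>Isolates what the graph has to supply for all symmetry statements: a palindromic
  numerator over (1 - t^N)^n. Balls are partial sums of spheres, so their series has one further
  factor 1 - t in the denominator.\<close>

lemma growth_series_consequences:
  fixes s b :: "nat \<Rightarrow> nat" and S :: "complex poly"
  assumes N: "N \<ge> 1" and deg: "degree S \<le> n * N"
    and pal: "\<And>k. k \<le> n * N \<Longrightarrow> coeff S (n * N - k) = coeff S k"
    and S: "gen_series s * fps_of_poly ((1 - monom 1 N) ^ n) = fps_of_poly S"
    and b: "\<And>i. b i = (\<Sum>j\<le>i. s j)"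
  shows "quasi_polynomial_on_ge 0 b"
    and "\<exists>Gb Gs :: complex poly fract.
         has_power_series Gb (gen_series b) \<and>
         has_power_series Gs (gen_series s) \<and>
         ratfun_subst Gb (1 / ratfun_var) = (- 1) ^ (n + 1) * ratfun_var * Gb \<and>
         ratfun_subst Gs (1 / ratfun_var) = (- 1) ^ n * Gs"
    and "\<forall>fb. corresponding_quasi_polynomial b fb \<longrightarrow>
         (\<forall>i::int. fb (- i) = (- 1) ^ n * fb (i - 1))"
    and "\<forall>fs. corresponding_quasi_polynomial s fs \<longrightarrow>
         (\<forall>i::int. i \<noteq> 0 \<longrightarrow> fs (- i) = (- 1) ^ (n + 1) * fs i)"
proof -
  let ?M = "Suc n * N"
  \<comment> \<open>The factor 1 + t + ... + t^(N - 1) extends 1 - t to 1 - t^N. It is palindromic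
    of degree N - 1, so \<open>S * U\<close> is palindromic of formal degree (n + 1) * N -
    1.\<close>
  define U :: "complex poly" where "U = (\<Sum>j<N. monom 1 j)"
  have U: "U * (1 - monom 1 1) = 1 - monom 1 N"
  proof -
    have m: "monom 1 j = (monom 1 1 :: complex poly) ^ j" for j by (simp add: monom_power)
    have "(1 - monom 1 1) * (\<Sum>j<N. (monom 1 1 :: complex poly) ^ j) = 1 - monom 1 1 ^ N"
      by (rule one_diff_power_eq[symmetric])
    then show ?thesis unfolding U_def m[of N] by (simp add: monom_power mult.commute)
  qed
  define P where "P = S * U"
  have coeffU: "coeff U j = (if j < N then 1 else 0)" for j
    by (simp add: U_def coeff_sum)
  have coeffP: "coeff P k = (\<Sum>j<N. if j \<le> k then coeff S (k - j) else 0)" for k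
  proof -
    have "coeff P k = (\<Sum>j\<le>k. coeff U j * coeff S (k - j))"
      unfolding P_def mult.commute[of S] by (rule coeff_mult)
    also have "\<dots> = (\<Sum>j\<in>{..k} \<inter> {..<N}. coeff S (k - j))"
      by (auto simp: coeffU sum.inter_restrict intro!: sum.cong)
    also have "\<dots> = (\<Sum>j<N. if j \<le> k then coeff S (k - j) else 0)"
      unfolding Int_commute[of "{..k}"] by (simp add: sum.inter_restrict)
    finally show ?thesis .
  qed
  have S0: "coeff S k = 0" if "k > n * N" for k using that deg by (simp add: coeff_eq_0)
  have palP: "coeff P (?M - 1 - k) = coeff P k" if k: "k < ?M" for k
  proof -
    have "coeff P (?M - 1 - k) = (\<Sum>j<N. if N - Suc j \<le> ?M - 1 - k then coeff S (?M - 1 - k - (N - Suc j)) else 0)"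
      unfolding coeffP by (rule sum.nat_diff_reindex[symmetric])
    also have "\<dots> = (\<Sum>j<N. if j \<le> k then coeff S (k - j) else 0)"
    proof (rule sum.cong)
      fix j assume "j \<in> {..<N}"
      then have j: "j < N" by simp
      show "(if N - Suc j \<le> ?M - 1 - k then coeff S (?M - 1 - k - (N - Suc j)) else 0) = (if j \<le> k then coeff S (k - j) else 0)"
      proof (cases "j \<le> k")
        case jk: True
        show ?thesis
        proof (cases "k - j \<le> n * N")
          case True
          then have "N - Suc j \<le> ?M - 1 - k" "?M - 1 - k - (N - Suc j) = n * N - (k - j)"
            using j jk k by auto
          then show ?thesis using jk pal[OF True] by simp
        next
          case False
          then have "\<not> N - Suc j \<le> ?M - 1 - k" using j jk k by auto
          then show ?thesis using S0[of "k - j"] False by simp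
        qed
      next
        case False
        then have "?M - 1 - k - (N - Suc j) > n * N" using j k by auto
        then show ?thesis using False S0 by simp
      qed
    qed simp
    finally show ?thesis by (rule trans[OF _ coeffP[of k, symmetric]])
  qed
  \<comment> \<open>Strictly below the degree of the denominator, which makes the balls
    quasi-polynomial already from i = 0.\<close>
  have degP: "degree P < ?M"
  proof -
    have "degree U \<le> N - 1"
      by (rule degree_le) (use N in \<open>auto simp: coeffU\<close>)
    then have "degree P \<le> n * N + (N - 1)"
      unfolding P_def using deg degree_mult_le[of S U] by linarith
    then show ?thesis using N by simp
  qed
  have b_series: "gen_series b * (1 - fps_X) = gen_series s"
  proof (rule fps_ext)
    fix i show "(gen_series b * (1 - fps_X)) $ i = gen_series s $ i"
      using fps_mult_one_minus_X_power_nth[of "gen_series b" 1 i]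
      by (cases i) (simp_all add: gen_series_def b)
  qed
  have P: "gen_series b * fps_of_poly ((1 - monom 1 N) ^ Suc n) = fps_of_poly P"
  proof -
    have "(1 - monom 1 N :: complex poly) ^ Suc n = (1 - monom 1 1) * (U * (1 - monom 1 N) ^ n)"
      unfolding power_Suc by (subst (1) U[symmetric]) (simp add: algebra_simps)
    moreover have "fps_of_poly (1 - monom 1 1 :: complex poly) = 1 - fps_X"
      by (simp add: fps_of_poly_diff fps_of_poly_monom)
    ultimately have "gen_series b * fps_of_poly ((1 - monom 1 N) ^ Suc n)
        = gen_series b * (1 - fps_X) * (fps_of_poly U * fps_of_poly ((1 - monom 1 N) ^ n))"
      by (simp only: fps_of_poly_mult mult.assoc)
    also have "\<dots> = fps_of_poly U * (gen_series s * fps_of_poly ((1 - monom 1 N) ^ n))"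
      unfolding b_series by (simp only: ac_simps)
    also have "\<dots> = fps_of_poly P"
      unfolding S P_def by (simp only: fps_of_poly_mult mult.commute)
    finally show ?thesis .
  qed
  define f where "f = expansion_quasi_poly N n P"
  have f: "quasi_polynomial f" unfolding f_def by (rule quasi_polynomial_expansion[OF N])
  have bf: "of_nat (b i) = f (int i)" for i
    using expansion_quasi_poly_nth[OF N degP P, of i] by (simp add: f_def gen_series_def)
  have refl: "f (- i) = (- 1) ^ n * f (i - 1)" for i
    unfolding f_def by (rule expansion_quasi_poly_reflect[OF N palP])
  show "quasi_polynomial_on_ge 0 b"
    unfolding quasi_polynomial_on_ge_def using f bf by blast
  show "\<forall>fb. corresponding_quasi_polynomial b fb \<longrightarrow> (\<forall>i::int. fb (- i) = (- 1) ^ n * fb (i - 1))"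
  proof (intro allI impI)
    fix fb and i :: int assume "corresponding_quasi_polynomial b fb"
    then obtain m where "quasi_polynomial fb" "\<And>i. i \<ge> m \<Longrightarrow> of_nat (b i) = fb (int i)"
      unfolding corresponding_quasi_polynomial_def by blast
    then have "fb = f" using quasi_polynomial_eqI[of fb f m] f bf by simp
    then show "fb (- i) = (- 1) ^ n * fb (i - 1)" using refl by simp
  qed
  \<comment> \<open>The backward difference of \<open>f\<close> is the quasi-polynomial of the
    spheres. On the class of j its second term comes from the class of j - 1; adding
    \<open>N\<close> first keeps the natural subtraction exact at j = 0.\<close>
  have shift: "quasi_polynomial (\<lambda>i. f i - f (i - 1))"
  proof -
    obtain N Q where N: "N \<ge> (1::nat)" and Q: "\<And>j m. j < N \<Longrightarrow> [m = int j] (mod int N) \<Longrightarrow> f m = poly (Q j) (of_int m)"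
      using f unfolding quasi_polynomial_def by blast
    define Q' where "Q' j = Q j - pcompose (Q ((j + N - 1) mod N)) [:- 1, 1:]" for j
    have "f m - f (m - 1) = poly (Q' j) (of_int m)" if "j < N" and m: "[m = int j] (mod int N)" for j m
    proof -
      have "[m - 1 = int ((j + N - 1) mod N)] (mod int N)"
      proof -
        have "int ((j + N - 1) mod N) = (int j - 1 + int N) mod int N"
          using N by (simp add: zmod_int of_nat_diff algebra_simps)
        also have "\<dots> = (int j - 1) mod int N" by simp
        finally have "int ((j + N - 1) mod N) = (int j - 1) mod int N" .
        moreover have "(m - 1) mod int N = (int j - 1) mod int N"
          using cong_diff[OF m cong_refl[of 1]] by (simp add: cong_def)
        ultimately show ?thesis by (simp add: cong_def)
      qed
      then have "f (m - 1) = poly (Q ((j + N - 1) mod N)) (of_int (m - 1))"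
        by (rule Q[rotated]) (use N in simp)
      then show ?thesis using Q[OF that] by (simp add: Q'_def poly_pcompose)
    qed
    then show ?thesis unfolding quasi_polynomial_def using N by blast
  qed
  show "\<forall>fs. corresponding_quasi_polynomial s fs \<longrightarrow>
         (\<forall>i::int. i \<noteq> 0 \<longrightarrow> fs (- i) = (- 1) ^ (n + 1) * fs i)"
  proof (intro allI impI)
    fix fs and i :: int assume "corresponding_quasi_polynomial s fs"
    then obtain m where fs: "quasi_polynomial fs" "\<And>i. i \<ge> m \<Longrightarrow> of_nat (s i) = fs (int i)"
      unfolding corresponding_quasi_polynomial_def by blast
    have "fs = (\<lambda>i. f i - f (i - 1))"
    proof (rule quasi_polynomial_eqI[OF fs(1) shift])
      fix i :: nat assume i: "i \<ge> Suc m"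
      then obtain k where k: "i = Suc k" by (cases i) auto
      then have "b i = b k + s i" by (simp add: b)
      then have "of_nat (s i) = f (int i) - f (int k)"
        by (simp flip: bf)
      then show "fs (int i) = f (int i) - f (int i - 1)"
        using fs(2)[of i] i k by simp
    qed
    \<comment> \<open>Reflection at i and at i + 1 gives f (- i) - f (- i - 1) = (-1)^n * (f (i - 1)
      - f i), and the exchanged order costs one more sign.\<close>
    moreover have "f (- i - 1) = (- 1) ^ n * f i"
    proof -
      have "- i - 1 = - (i + 1)" by simp
      then show ?thesis using refl[of "i + 1"] by (simp only: add_diff_cancel_right')
    qed
    ultimately show "fs (- i) = (- 1) ^ (n + 1) * fs i"
      using refl[of i] by (simp add: algebra_simps)
  qed
  have nz: "(1 - monom 1 N :: complex poly) ^ r \<noteq> 0" for r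
    by (rule power_not_zero[OF one_minus_monom_nonzero[OF N]])
  show "\<exists>Gb Gs :: complex poly fract.
         has_power_series Gb (gen_series b) \<and>
         has_power_series Gs (gen_series s) \<and>
         ratfun_subst Gb (1 / ratfun_var) = (- 1) ^ (n + 1) * ratfun_var * Gb \<and>
         ratfun_subst Gs (1 / ratfun_var) = (- 1) ^ n * Gs"
  proof (intro exI conjI)
    show "has_power_series (Fract P ((1 - monom 1 N) ^ Suc n)) (gen_series b)"
      unfolding has_power_series_def using P nz by blast
    show "has_power_series (Fract S ((1 - monom 1 N) ^ n)) (gen_series s)"
      unfolding has_power_series_def using S nz by blast
    have "?M - (?M - 1) = 1" using N by (simp add: Suc_le_eq)
    then show "ratfun_subst (Fract P ((1 - monom 1 N) ^ Suc n)) (1 / ratfun_var)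
        = (- 1) ^ (n + 1) * ratfun_var * Fract P ((1 - monom 1 N) ^ Suc n)"
      using ratfun_subst_palindromic[OF N, of P "?M - 1" "Suc n"] degP palP by simp
    show "ratfun_subst (Fract S ((1 - monom 1 N) ^ n)) (1 / ratfun_var)
        = (- 1) ^ n * Fract S ((1 - monom 1 N) ^ n)"
      using ratfun_subst_palindromic[OF N deg] pal by simp
  qed
qed

section \<open>Distances in periodic graphs\<close>

lemma walk_weight_simps [simp]:
  "walk_weight w [] = 0"
  "walk_weight w (e # p) = w e + walk_weight w p"
  "walk_weight w (p @ q) = walk_weight w p + walk_weight w q"
  by (simp_all add: walk_weight_def)

lemma map_eq_append_ConsD:
  assumes "map f p = xs @ y # zs"
  shows "\<exists>p1 e r. p = p1 @ e # r \<and> f e = y \<and> map f r = zs"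
  using assms by (auto simp: map_eq_append_conv Cons_eq_map_conv)

locale periodic =
  fixes \<Gamma> :: "('v, 'e, 'a::euclidean_space) pgraph" and n :: nat
  assumes periodic: "periodic_graph n \<Gamma>"
begin

abbreviation "L \<equiv> lat \<Gamma>"
abbreviation "VV \<equiv> verts (graph \<Gamma>)"
abbreviation "EE \<equiv> arcs (graph \<Gamma>)"
abbreviation "sh \<equiv> vshift \<Gamma>"
abbreviation "esh \<equiv> eshift \<Gamma>"
abbreviation "wt \<equiv> walk_weight (weight \<Gamma>)"
abbreviation "PP \<equiv> growth_polytope \<Gamma>"

sublocale wf_digraph "graph \<Gamma>"
  using periodic by (simp add: periodic_graph_def)

lemma full_lattice: "is_full_lattice n L"
  using periodic by (simp add: periodic_graph_def)

lemma zero_in_lat: "0 \<in> L"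
proof -
  obtain B where "L = {\<Sum>b\<in>B. real_of_int (c b) *\<^sub>R b | c. True}"
    using full_lattice unfolding is_full_lattice_def by blast
  then show ?thesis by (auto intro!: exI[of _ "\<lambda>_. 0"])
qed

lemma diff_in_lat:
  assumes "u \<in> L" "u' \<in> L"
  shows "u - u' \<in> L"
proof -
  obtain B where B: "L = {\<Sum>b\<in>B. real_of_int (c b) *\<^sub>R b | c. True}"
    using full_lattice unfolding is_full_lattice_def by blast
  obtain c c' where "u = (\<Sum>b\<in>B. real_of_int (c b) *\<^sub>R b)" "u' = (\<Sum>b\<in>B. real_of_int (c' b) *\<^sub>R b)"
    using assms unfolding B by blast
  then have "u - u' = (\<Sum>b\<in>B. real_of_int (c b - c' b) *\<^sub>R b)"
    by (simp add: sum_subtractf scaleR_diff_left)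
  then show ?thesis unfolding B by (intro CollectI exI[of _ "\<lambda>b. c b - c' b"]) simp
qed

lemma uminus_in_lat: "- u \<in> L" if "u \<in> L"
  using diff_in_lat[OF zero_in_lat that] by simp

lemma add_in_lat: "u + u' \<in> L" if "u \<in> L" "u' \<in> L"
  using diff_in_lat[OF that(1) uminus_in_lat[OF that(2)]] by simp

lemma nat_scale_in_lat: "real k *\<^sub>R u \<in> L" if "u \<in> L"
  by (induction k) (simp_all add: zero_in_lat add_in_lat that scaleR_add_left)

lemma sum_in_lat: "sum f A \<in> L" if "\<And>a. a \<in> A \<Longrightarrow> f a \<in> L"
  using that by (induction A rule: infinite_finite_induct) (simp_all add: zero_in_lat add_in_lat)

lemma span_lat: "span L = UNIV"
proof -
  obtain B where B: "independent B" "span B = UNIV" "L = {\<Sum>b\<in>B. real_of_int (c b) *\<^sub>R b | c. True}"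
    using full_lattice unfolding is_full_lattice_def by blast
  have "b \<in> L" if "b \<in> B" for b
  proof -
    have "(\<Sum>b'\<in>B. real_of_int (if b' = b then 1 else 0) *\<^sub>R b') = (\<Sum>b'\<in>B. if b' = b then b' else 0)"
      by (rule sum.cong) auto
    also have "\<dots> = b"
      using that independent_imp_finite[OF B(1)] by simp
    finally have "b = (\<Sum>b'\<in>B. real_of_int ((\<lambda>b'. if b' = b then 1 else 0) b') *\<^sub>R b')" by simp
    then show ?thesis unfolding B by (intro CollectI exI[of _ "\<lambda>b'. if b' = b then 1 else 0"]) simp
  qed
  then have "span B \<subseteq> span L" by (simp add: span_mono subsetI)
  then show ?thesis using B by auto
qed

lemma DIM_eq: "DIM('a) = n"
proof -
  obtain B :: "'a set" where B: "independent B" "span B = UNIV" "card B = n"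
    using full_lattice unfolding is_full_lattice_def by blast
  then have "dim (UNIV :: 'a set) = n" by (metis dim_eq_card_independent dim_span)
  then show ?thesis by (simp add: dim_UNIV)
qed

lemma free_verts: "free_action_on L sh VV" and free_arcs: "free_action_on L esh EE"
  using periodic by (simp_all add: periodic_graph_def)

lemma sh_in: "u \<in> L \<Longrightarrow> x \<in> VV \<Longrightarrow> sh u x \<in> VV"
  and sh_0: "x \<in> VV \<Longrightarrow> sh 0 x = x"
  and sh_add: "u \<in> L \<Longrightarrow> u' \<in> L \<Longrightarrow> x \<in> VV \<Longrightarrow> sh u (sh u' x) = sh (u + u') x"
  and sh_fixed: "u \<in> L \<Longrightarrow> x \<in> VV \<Longrightarrow> sh u x = x \<Longrightarrow> u = 0"
  using free_verts unfolding free_action_on_def by auto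

lemma esh_in: "u \<in> L \<Longrightarrow> e \<in> EE \<Longrightarrow> esh u e \<in> EE"
  and esh_0: "e \<in> EE \<Longrightarrow> esh 0 e = e"
  using free_arcs unfolding free_action_on_def by auto

lemma tail_esh: "u \<in> L \<Longrightarrow> e \<in> EE \<Longrightarrow> tail (graph \<Gamma>) (esh u e) = sh u (tail (graph \<Gamma>) e)"
  and head_esh: "u \<in> L \<Longrightarrow> e \<in> EE \<Longrightarrow> head (graph \<Gamma>) (esh u e) = sh u (head (graph \<Gamma>) e)"
  and weight_esh: "u \<in> L \<Longrightarrow> e \<in> EE \<Longrightarrow> weight \<Gamma> (esh u e) = weight \<Gamma> e"
  and weight_pos: "e \<in> EE \<Longrightarrow> weight \<Gamma> e > 0"
  using periodic by (simp_all add: periodic_graph_def)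

lemma sh_inj:
  assumes "sh u x = sh u' x" "u \<in> L" "u' \<in> L" "x \<in> VV"
  shows "u = u'"
proof -
  have "sh (- u' + u) x = sh (- u') (sh u x)"
    using assms(2-4) by (simp only: sh_add uminus_in_lat)
  also have "\<dots> = x" unfolding assms(1) using assms(2-4) by (simp add: sh_add uminus_in_lat sh_0)
  finally have "- u' + u = 0"
    using assms(2-4) by (intro sh_fixed[of _ x] add_in_lat uminus_in_lat) simp_all
  then show ?thesis by simp
qed

lemma sh_inj_vertex:
  assumes "sh u x = sh u y" "u \<in> L" "x \<in> VV" "y \<in> VV"
  shows "x = y"
proof -
  have "x = sh (- u) (sh u x)" using assms(2-4) by (simp add: sh_add uminus_in_lat sh_0)
  also have "\<dots> = y" unfolding assms(1) using assms(2-4) by (simp add: sh_add uminus_in_lat sh_0)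
  finally show ?thesis .
qed

lemma vorbit_sh: "u \<in> L \<Longrightarrow> x \<in> VV \<Longrightarrow> vorbit \<Gamma> (sh u x) = vorbit \<Gamma> x"
proof -
  assume u: "u \<in> L" and x: "x \<in> VV"
  have "sh u' x \<in> vorbit \<Gamma> (sh u x)" if "u' \<in> L" for u'
    unfolding vorbit_def
    by (rule image_eqI[of _ _ "u' - u"]) (use u x that in \<open>simp_all add: sh_add diff_in_lat\<close>)
  then show ?thesis using u x by (auto simp: vorbit_def sh_add add_in_lat)
qed

lemma vorbit_eqE:
  assumes "vorbit \<Gamma> x = vorbit \<Gamma> y" "y \<in> VV"
  obtains u where "u \<in> L" "y = sh u x"
proof -
  have "y \<in> vorbit \<Gamma> y" using assms(2) zero_in_lat sh_0 by (force simp: vorbit_def)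
  then show ?thesis using that assms(1) by (auto simp: vorbit_def)
qed

lemma eorbit_eqE:
  assumes "eorbit \<Gamma> e = eorbit \<Gamma> f" "f \<in> EE"
  obtains u where "u \<in> L" "f = esh u e"
proof -
  have "f \<in> eorbit \<Gamma> f" using assms(2) zero_in_lat esh_0 by (force simp: eorbit_def)
  then show ?thesis using that assms(1) by (auto simp: eorbit_def)
qed

section \<open>Displacements of closed walks and the quotient graph\<close>

lemma awalk_shift:
  assumes "awalk x p y" "u \<in> L"
  shows "awalk (sh u x) (map (esh u) p) (sh u y)" "wt (map (esh u) p) = wt p"
  using assms
  by (induction p arbitrary: x) (auto simp: awalk_simps sh_in esh_in tail_esh head_esh weight_esh)

text \<open>Unique lifting for the covering of the quotient. Corresponding arcs lie in one orbit, so
  they differ by a shift, which freeness reads off from their tails; hence it remains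
  \<open>a\<close> along the whole walk.\<close>

lemma awalk_lift_unique:
  assumes "awalk x p y" "awalk (sh a x) p' y'" "map (eorbit \<Gamma>) p = map (eorbit \<Gamma>) p'" "a \<in> L"
  shows "y' = sh a y"
  using assms
proof (induction p arbitrary: x p')
  case Nil
  then show ?case by (auto simp: awalk_simps)
next
  case (Cons e p)
  then obtain e' r where p': "p' = e' # r" by (cases p') auto
  have e: "e \<in> EE" "x = tail (graph \<Gamma>) e" "awalk (head (graph \<Gamma>) e) p y"
    using Cons.prems by (auto simp: awalk_simps)
  have e': "e' \<in> EE" "sh a x = tail (graph \<Gamma>) e'" "awalk (head (graph \<Gamma>) e') r y'"
    using Cons.prems p' by (auto simp: awalk_simps)
  obtain b where b: "b \<in> L" "e' = esh b e"
    using eorbit_eqE[of e e'] Cons.prems(3) p' e' by auto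
  then have "sh a x = sh b x" using e e' by (simp add: tail_esh)
  then have "b = a" using sh_inj[of a x b] b e Cons.prems(4) by simp
  then show ?case using Cons.IH[OF e(3), of r] e' b e Cons.prems p' by (simp add: head_esh)
qed

text \<open>The displacement depends only on the image of the walk, so the definite description in
  \<open>mu\<close> denotes. Nonemptiness provides a first arc, by which the start points of two
  lifts are compared.\<close>

lemma mu_eqI:
  assumes p: "awalk x p (sh u x)" "p \<noteq> []" and u: "u \<in> L"
  shows "mu \<Gamma> (map (eorbit \<Gamma>) p) = u"
  unfolding mu_def
proof (rule the_equality)
  show "u \<in> L \<and> (\<exists>x p'. awalk x p' (sh u x) \<and> map (eorbit \<Gamma>) p' = map (eorbit \<Gamma>) p)"
    using assms by blast
next
  fix u' assume "u' \<in> L \<and> (\<exists>x p'. awalk x p' (sh u' x) \<and> map (eorbit \<Gamma>) p' = map (eorbit \<Gamma>) p)"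
  then obtain x' p' where u': "u' \<in> L" and p': "awalk x' p' (sh u' x')" "map (eorbit \<Gamma>) p = map (eorbit \<Gamma>) p'"
    by metis
  obtain e r e' r' where er: "p = e # r" "p' = e' # r'"
    using assms(2) p'(2) by (cases p; cases p') auto
  have e: "e \<in> EE" "x = tail (graph \<Gamma>) e" "x \<in> VV" using p er by (auto simp: awalk_simps)
  have e': "e' \<in> EE" "x' = tail (graph \<Gamma>) e'" "x' \<in> VV" using p' er by (auto simp: awalk_simps)
  obtain b where b: "b \<in> L" "e' = esh b e"
    using eorbit_eqE[of e e'] er p' e' by auto
  then have x': "x' = sh b x" using e e' by (simp add: tail_esh)
  have "sh u' x' = sh b (sh u x)"
    using awalk_lift_unique[OF p(1) _ p'(2) b(1)] p'(1) x' by simp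
  also have "\<dots> = sh u x'" using b u e x' by (simp add: sh_add add.commute)
  finally show "u' = u" using sh_inj u u' e' by blast
qed

lemma quot_weight_eorbit: "e \<in> EE \<Longrightarrow> quot_weight \<Gamma> (eorbit \<Gamma> e) = weight \<Gamma> e"
proof -
  assume e: "e \<in> EE"
  have "weight \<Gamma> ` eorbit \<Gamma> e = {weight \<Gamma> e}"
    using e zero_in_lat by (auto simp: eorbit_def weight_esh image_iff intro!: bexI[of _ 0])
  then show ?thesis by (simp add: quot_weight_def)
qed

lemma walk_weight_quot: "set p \<subseteq> EE \<Longrightarrow> walk_weight (quot_weight \<Gamma>) (map (eorbit \<Gamma>) p) = wt p"
  by (induction p) (simp_all add: quot_weight_eorbit)

lemma tail_quot: "e \<in> EE \<Longrightarrow> tail (quot_graph \<Gamma>) (eorbit \<Gamma> e) = vorbit \<Gamma> (tail (graph \<Gamma>) e)"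
  by (auto simp: quot_graph_def eorbit_def vorbit_def tail_esh image_image cong: image_cong_simp)

lemma head_quot: "e \<in> EE \<Longrightarrow> head (quot_graph \<Gamma>) (eorbit \<Gamma> e) = vorbit \<Gamma> (head (graph \<Gamma>) e)"
  by (auto simp: quot_graph_def eorbit_def vorbit_def head_esh image_image cong: image_cong_simp)

lemma awalk_quot:
  assumes "awalk x p y"
  shows "pre_digraph.awalk (quot_graph \<Gamma>) (vorbit \<Gamma> x) (map (eorbit \<Gamma>) p) (vorbit \<Gamma> y)"
proof -
  have "pre_digraph.cas (quot_graph \<Gamma>) (vorbit \<Gamma> x) (map (eorbit \<Gamma>) p) (vorbit \<Gamma> y)"
    using assms
    by (induction p arbitrary: x) (auto simp: awalk_simps pre_digraph.cas.simps tail_quot head_quot)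
  moreover have "x \<in> VV" "set p \<subseteq> EE" using assms by auto
  ultimately show ?thesis
    unfolding pre_digraph.awalk_def by (auto simp: quot_graph_def)
qed

text \<open>Distinct heads force distinct arcs, so a cycle is a repetition-free list over finitely
  many arc orbits.\<close>

lemma finite_quot_cycles: "finite {q. pre_digraph.cycle (quot_graph \<Gamma>) q}"
proof (rule finite_subset)
  have fin: "finite (eorbit \<Gamma> ` EE)" using periodic by (simp add: periodic_graph_def)
  then show "finite {q. set q \<subseteq> eorbit \<Gamma> ` EE \<and> distinct q}"
    by (rule finite_subset_distinct)
  show "{q. pre_digraph.cycle (quot_graph \<Gamma>) q} \<subseteq> {q. set q \<subseteq> eorbit \<Gamma> ` EE \<and> distinct q}"
  proof (clarsimp, intro conjI)
    fix q assume "pre_digraph.cycle (quot_graph \<Gamma>) q"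
    then obtain X where X: "pre_digraph.awalk (quot_graph \<Gamma>) X q X"
      "distinct (tl (pre_digraph.awalk_verts (quot_graph \<Gamma>) X q))" "q \<noteq> []"
      unfolding pre_digraph.cycle_def by blast
    have cas: "pre_digraph.cas (quot_graph \<Gamma>) X q X" "set q \<subseteq> arcs (quot_graph \<Gamma>)"
      using X(1) unfolding pre_digraph.awalk_def by auto
    show "set q \<subseteq> eorbit \<Gamma> ` EE" using cas(2) by (simp add: quot_graph_def)
    show "distinct q"
      using X(2,3) pre_digraph.awalk_verts_conv'[OF cas(1)] by (auto simp: distinct_map)
  qed
qed

text \<open>A closed walk of the quotient splits into cycles, and displacement and weight are additive.\<close>

lemma closed_walk_bound:
  assumes cyc: "\<And>q. pre_digraph.cycle (quot_graph \<Gamma>) q \<Longrightarrow>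
      a \<bullet> mu \<Gamma> q \<le> c * real (walk_weight (quot_weight \<Gamma>) q)"
    and "awalk x p (sh u x)" "u \<in> L"
  shows "a \<bullet> u \<le> c * real (wt p)"
  using assms(2,3)
proof (induction p arbitrary: x u rule: length_induct)
  case (1 p)
  note p = "1.prems"(1) and u = "1.prems"(2)
  have x: "x \<in> VV" using p by auto
  have pE: "set p \<subseteq> EE" using p by auto
  consider "p = []" | "p \<noteq> []" "distinct (map (\<lambda>e. vorbit \<Gamma> (head (graph \<Gamma>) e)) p)"
    | "\<not> distinct (map (\<lambda>e. vorbit \<Gamma> (head (graph \<Gamma>) e)) p)" by blast
  then show ?case
  proof cases
    case 1
    then have "u = 0" using p u x by (simp add: awalk_simps sh_fixed)
    then show ?thesis using 1 by simp
  next
    case 2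
    let ?q = "map (eorbit \<Gamma>) p"
    have q: "pre_digraph.awalk (quot_graph \<Gamma>) (vorbit \<Gamma> x) ?q (vorbit \<Gamma> x)"
      using awalk_quot[OF p] vorbit_sh[OF u x] by simp
    then have "pre_digraph.cas (quot_graph \<Gamma>) (vorbit \<Gamma> x) ?q (vorbit \<Gamma> x)"
      unfolding pre_digraph.awalk_def by blast
    then have "tl (pre_digraph.awalk_verts (quot_graph \<Gamma>) (vorbit \<Gamma> x) ?q) = map (head (quot_graph \<Gamma>)) ?q"
      using 2(1) by (simp add: pre_digraph.awalk_verts_conv')
    also have "\<dots> = map (\<lambda>e. vorbit \<Gamma> (head (graph \<Gamma>) e)) p"
      using pE by (auto simp: head_quot)
    finally have "pre_digraph.cycle (quot_graph \<Gamma>) ?q"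
      unfolding pre_digraph.cycle_def using q 2 by auto
    then show ?thesis
      using cyc[of ?q] mu_eqI[OF p 2(1) u] walk_weight_quot[OF pE] by simp
  next
    case 3
    then obtain xs ys zs o' where "map (\<lambda>e. vorbit \<Gamma> (head (graph \<Gamma>) e)) p = xs @ [o'] @ ys @ [o'] @ zs"
      using not_distinct_decomp by blast
    then have "map (\<lambda>e. vorbit \<Gamma> (head (graph \<Gamma>) e)) p = xs @ o' # (ys @ o' # zs)" by simp
    from map_eq_append_ConsD[OF this] obtain p1 e1 r where "p = p1 @ e1 # r" and o1: "vorbit \<Gamma> (head (graph \<Gamma>) e1) = o'"
      and r: "map (\<lambda>e. vorbit \<Gamma> (head (graph \<Gamma>) e)) r = ys @ o' # zs"
      by blast
    moreover obtain p2 e2 p3 where "r = p2 @ e2 # p3"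
      and o2: "vorbit \<Gamma> (head (graph \<Gamma>) e2) = o'"
      using map_eq_append_ConsD[OF r] by blast
    ultimately have dec: "p = (p1 @ [e1]) @ (p2 @ [e2]) @ p3" by simp
    define A B where "A = p1 @ [e1]" and "B = p2 @ [e2]"
    have pdec: "p = A @ B @ p3" using dec by (simp add: A_def B_def)
    define h1 h2 where "h1 = head (graph \<Gamma>) e1" and "h2 = head (graph \<Gamma>) e2"
    have "e1 \<in> EE" "e2 \<in> EE" using pE dec by auto
    then have h: "h1 \<in> VV" "h2 \<in> VV" by (auto simp: h1_def h2_def)
    have lA: "awlast z A = h1" for z by (simp add: A_def h1_def awalk_verts_conv)
    have lB: "awlast z B = h2" for z by (simp add: B_def h2_def awalk_verts_conv)
    have wA: "awalk x A h1" and wB: "awalk h1 B h2" and wC: "awalk h2 p3 (sh u x)"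
      using p unfolding pdec awalk_append_iff lA lB by auto
    \<comment> \<open>Cutting out \<open>B\<close> leaves a gap from h1 to its translate h2 by v.
      The rest \<open>p3\<close> is moved back by v to close it, so the shortened walk has
      displacement u - v and \<open>B\<close> has displacement v.\<close>
    obtain v where v: "v \<in> L" "h2 = sh v h1"
      using vorbit_eqE[of h1 h2] o1 o2 h by (auto simp: h1_def h2_def)
    have h1: "sh (- v) h2 = h1" using v h by (simp add: sh_add uminus_in_lat sh_0)
    have "awalk h1 (map (esh (- v)) p3) (sh (u - v) x)"
      using awalk_shift(1)[OF wC uminus_in_lat[OF v(1)]] h1 u v x by (simp add: sh_add uminus_in_lat)
    then have "awalk x (A @ map (esh (- v)) p3) (sh (u - v) x)"
      using wA by (rule awalk_appendI[rotated])
    moreover have "length (A @ map (esh (- v)) p3) < length p" by (simp add: pdec B_def)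
    ultimately have "a \<bullet> (u - v) \<le> c * real (wt (A @ map (esh (- v)) p3))"
      using "1.IH" diff_in_lat[OF u v(1)] by blast
    moreover have "a \<bullet> v \<le> c * real (wt B)"
    proof -
      have "length B < length p" by (simp add: pdec A_def)
      then show ?thesis using "1.IH" wB v by blast
    qed
    ultimately show ?thesis
      unfolding pdec using awalk_shift(2)[OF wC uminus_in_lat[OF v(1)]]
      by (simp add: inner_diff_right algebra_simps)
  qed
qed

lemma cycle_weight_pos:
  assumes "pre_digraph.cycle (quot_graph \<Gamma>) q"
  shows "walk_weight (quot_weight \<Gamma>) q > 0"
proof -
  obtain X where "pre_digraph.awalk (quot_graph \<Gamma>) X q X" "q \<noteq> []"
    using assms unfolding pre_digraph.cycle_def by blast
  then have "set q \<subseteq> eorbit \<Gamma> ` EE" unfolding pre_digraph.awalk_def by (auto simp: quot_graph_def)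
  then show ?thesis using \<open>q \<noteq> []\<close>
    by (cases q) (auto simp: quot_weight_eorbit weight_pos add_pos_nonneg)
qed

lemma polytope_growth: "polytope PP"
  unfolding growth_polytope_def
  by (rule polytope_convex_hull) (simp add: finite_quot_cycles flip: image_Collect)

text \<open>The polytope is generated by 0 and cycle displacements divided by cycle weights, so a
  linear bound on it becomes a bound for each cycle on multiplying by the positive weight.\<close>

lemma closed_walk_bound_polytope:
  assumes "\<And>z. z \<in> PP \<Longrightarrow> a \<bullet> z \<le> c" "awalk x p (sh u x)" "u \<in> L"
  shows "a \<bullet> u \<le> c * real (wt p)"
proof (rule closed_walk_bound[OF _ assms(2,3)])
  fix q assume q: "pre_digraph.cycle (quot_graph \<Gamma>) q"
  let ?w = "real (walk_weight (quot_weight \<Gamma>) q)"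
  have "mu \<Gamma> q /\<^sub>R ?w \<in> PP"
    unfolding growth_polytope_def by (rule hull_inc) (use q in blast)
  then have "a \<bullet> (mu \<Gamma> q /\<^sub>R ?w) \<le> c" by (rule assms(1))
  then show "a \<bullet> mu \<Gamma> q \<le> c * ?w"
    using cycle_weight_pos[OF q] by (simp add: field_simps)
qed

end

locale connected_periodic = periodic \<Gamma> n
  for \<Gamma> :: "('v, 'e, 'a::euclidean_space) pgraph" and n :: nat +
  assumes conn: "strongly_conn \<Gamma>" and und: "undirected \<Gamma>"
begin

section \<open>The natural-number distance: invariance, symmetry, finite balls\<close>

definition dn :: "'v \<Rightarrow> 'v \<Rightarrow> nat" where
  "dn x y = the_enat (gdist \<Gamma> x y)"

lemma gdist_eq_dn: "x \<in> VV \<Longrightarrow> y \<in> VV \<Longrightarrow> gdist \<Gamma> x y = enat (dn x y)"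
  using conn by (metis strongly_conn_def dn_def not_infinity_eq the_enat.simps)

lemma dn_le: 
  assumes "awalk x p y"
  shows "dn x y \<le> wt p"
proof -
  have "x \<in> VV" "y \<in> VV" using assms by auto
  moreover have "gdist \<Gamma> x y \<le> enat (wt p)"
    unfolding gdist_def by (rule INF_lower) (use assms in simp)
  ultimately show ?thesis by (simp add: gdist_eq_dn)
qed

lemma dn_walk:
  assumes "x \<in> VV" "y \<in> VV"
  obtains p where "awalk x p y" "wt p = dn x y"
proof -
  let ?W = "(\<lambda>p. enat (wt p)) ` {p. awalk x p y}"
  have d: "Inf ?W = enat (dn x y)"
    using gdist_eq_dn[OF assms] unfolding gdist_def by simp
  have "?W \<noteq> {}"
  proof
    assume "?W = {}"
    then show False using d by (simp only: Inf_enat_def if_True refl enat.distinct)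
  qed
  then have "Inf ?W \<in> ?W" unfolding Inf_enat_def by (auto intro: LeastI)
  then show ?thesis using that unfolding d by auto
qed

lemma dn_self: "x \<in> VV \<Longrightarrow> dn x x = 0"
  using dn_le[of x "[]" x] by (simp add: awalk_simps)

lemma dn_triangle:
  assumes "x \<in> VV" "y \<in> VV" "z \<in> VV"
  shows "dn x z \<le> dn x y + dn y z"
proof -
  obtain p q where "awalk x p y" "wt p = dn x y" "awalk y q z" "wt q = dn y z"
    using dn_walk assms by metis
  then show ?thesis using dn_le[of x "p @ q" z] awalk_appendI by auto
qed

lemma dn_sh:
  assumes "x \<in> VV" "y \<in> VV" "u \<in> L"
  shows "dn (sh u x) (sh u y) = dn x y"
proof -
  have le: "dn (sh u x) (sh u y) \<le> dn x y" if xy: "x \<in> VV" "y \<in> VV" "u \<in> L" for x y u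
  proof -
    obtain p where "awalk x p y" "wt p = dn x y" using dn_walk[OF xy(1,2)] .
    then show ?thesis using dn_le[OF awalk_shift(1)[of x p y u]] awalk_shift(2)[of x p y u] xy(3) by simp
  qed
  have "dn x y = dn (sh (- u) (sh u x)) (sh (- u) (sh u y))"
    using assms by (simp add: sh_add uminus_in_lat sh_0)
  also have "\<dots> \<le> dn (sh u x) (sh u y)" using assms by (intro le) (simp_all add: sh_in uminus_in_lat)
  finally show ?thesis using le[OF assms] by simp
qed

lemma dn_sym:
  assumes "x \<in> VV" "y \<in> VV"
  shows "dn x y = dn y x"
proof -
  obtain rv where rv: "\<And>e. e \<in> EE \<Longrightarrow> rv e \<in> EE \<and> 
        tail (graph \<Gamma>) e = head (graph \<Gamma>) (rv e) \<and>
        head (graph \<Gamma>) e = tail (graph \<Gamma>) (rv e) \<and>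
        weight \<Gamma> e = weight \<Gamma> (rv e)"
    using und unfolding undirected_def by blast
  have rev: "awalk y (rev (map rv p)) x \<and> wt (rev (map rv p)) = wt p" if "awalk x p y" for x y p
    using that
  proof (induction p arbitrary: x)
    case (Cons e p)
    then have e: "e \<in> EE" "x = tail (graph \<Gamma>) e" "awalk (head (graph \<Gamma>) e) p y" by (auto simp: awalk_simps)
    have "awalk (head (graph \<Gamma>) e) [rv e] x" using rv[OF e(1)] e by (auto simp: awalk_simps)
    then show ?case using Cons.IH[OF e(3)] rv[OF e(1)] by (auto intro: awalk_appendI simp del: awalk_append_iff)
  qed (auto simp: awalk_simps)
  have le: "dn y x \<le> dn x y" if xy: "x \<in> VV" "y \<in> VV" for x y
  proof -
    obtain p where "awalk x p y" "wt p = dn x y" using dn_walk[OF xy] .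
    then show ?thesis using rev[of x p y] dn_le[of y "rev (map rv p)" x] by simp
  qed
  show ?thesis using le[of x y] le[of y x] assms by simp
qed

text \<open>There are finitely many arc orbits, and by freeness an orbit contains at most one arc
  with a given tail.\<close>

lemma finite_out_arcs: "finite {e \<in> EE. tail (graph \<Gamma>) e = x}"
proof (rule finite_imageD)
  have "finite (eorbit \<Gamma> ` EE)" using periodic by (simp add: periodic_graph_def)
  then show "finite (eorbit \<Gamma> ` {e \<in> EE. tail (graph \<Gamma>) e = x})"
    by (rule finite_subset[rotated]) auto
  show "inj_on (eorbit \<Gamma>) {e \<in> EE. tail (graph \<Gamma>) e = x}"
  proof (rule inj_onI, clarify)
    fix e f assume e: "e \<in> EE" "x = tail (graph \<Gamma>) e" and f: "f \<in> EE" "tail (graph \<Gamma>) f = tail (graph \<Gamma>) e"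
      and "eorbit \<Gamma> e = eorbit \<Gamma> f"
    then obtain u where u: "u \<in> L" "f = esh u e" using eorbit_eqE by blast
    then have "u = 0" using e f sh_fixed[of u "tail (graph \<Gamma>) e"] by (simp add: tail_esh)
    then show "e = f" using u e by (simp add: esh_0)
  qed
qed

text \<open>Removing the first arc of a walk lowers its weight by at least 1, which reduces a ball
  to finitely many balls of smaller radius.\<close>

lemma finite_ball: "finite {y \<in> VV. dn x y \<le> i}" if "x \<in> VV"
proof -
  have fin: "finite {y. \<exists>p. awalk x p y \<and> wt p \<le> i}" for x
  proof (induction i arbitrary: x)
    case 0
    have "y = x" if "awalk x p y" "wt p \<le> 0" for p y
    proof (cases p)
      case (Cons e p)
      then show ?thesis using that weight_pos[of e] by (auto simp: awalk_simps)
    qed (use that in \<open>auto simp: awalk_simps\<close>)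
    then have "{y. \<exists>p. awalk x p y \<and> wt p \<le> 0} \<subseteq> {x}" by blast
    then show ?case by (rule finite_subset) simp
  next
    case (Suc i)
    have "y = x \<or> (\<exists>e\<in>{e \<in> EE. tail (graph \<Gamma>) e = x}. \<exists>r. awalk (head (graph \<Gamma>) e) r y \<and> wt r \<le> i)"
      if "awalk x p y" "wt p \<le> Suc i" for p y
    proof (cases p)
      case (Cons e r)
      then have "e \<in> EE" "tail (graph \<Gamma>) e = x" "awalk (head (graph \<Gamma>) e) r y" "weight \<Gamma> e + wt r \<le> Suc i"
        using that by (auto simp: awalk_simps)
      moreover have "wt r \<le> i" using weight_pos[of e] calculation by linarith
      ultimately show ?thesis by blast
    qed (use that in \<open>auto simp: awalk_simps\<close>)
    then have "{y. \<exists>p. awalk x p y \<and> wt p \<le> Suc i} \<subseteq>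
        insert x (\<Union>e\<in>{e \<in> EE. tail (graph \<Gamma>) e = x}. {y. \<exists>r. awalk (head (graph \<Gamma>) e) r y \<and> wt r \<le> i})"
      by blast
    then show ?case by (rule finite_subset) (use Suc finite_out_arcs in auto)
  qed
  show ?thesis
  proof (rule finite_subset[OF _ fin[of x]])
    show "{y \<in> VV. dn x y \<le> i} \<subseteq> {y. \<exists>p. awalk x p y \<and> wt p \<le> i}"
      by (rule subsetI, clarify, rule dn_walk[OF that]) auto
  qed
qed

text \<open>The lower bound by the gauge of the polytope, for one functional at a time.\<close>

lemma dn_bound:
  assumes "\<And>z. z \<in> PP \<Longrightarrow> a \<bullet> z \<le> 1" "x \<in> VV" "u \<in> L"
  shows "a \<bullet> u \<le> real (dn x (sh u x))"
proof -
  obtain p where "awalk x p (sh u x)" "wt p = dn x (sh u x)"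
    using dn_walk[OF assms(2) sh_in[OF assms(3,2)]] .
  then show ?thesis using closed_walk_bound_polytope[OF assms(1) _ assms(3), of x p] by simp
qed

text \<open>Otherwise some nonzero functional is at most 0 on the polytope, hence on every lattice
  vector, since connectedness makes it the displacement of a walk. Applied to u and -u, this makes
  the functional vanish on the lattice, which spans the space.\<close>

lemma zero_in_interior:
  assumes "VV \<noteq> {}"
  shows "0 \<in> interior PP"
proof (rule ccontr)
  assume nint: "0 \<notin> interior PP"
  have conv: "convex PP" by (simp add: polytope_imp_convex polytope_growth)
  have zero: "0 \<in> PP" unfolding growth_polytope_def by (rule hull_inc) simp
  obtain x where x: "x \<in> VV" using assms by blast
  \<comment> \<open>A flat polytope lies in a hyperplane, which passes through 0; a solid one has a
    supporting hyperplane at its boundary point 0.\<close>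
  obtain a where a: "a \<noteq> 0" "\<And>z. z \<in> PP \<Longrightarrow> a \<bullet> z \<le> 0"
  proof (cases "interior PP = {}")
    case True
    obtain a b where ab: "a \<noteq> 0" "PP \<subseteq> {x. a \<bullet> x = b}"
      using empty_interior_subset_hyperplane[OF conv True] by blast
    then have "b = 0" using zero by auto
    then have "a \<bullet> z \<le> 0" if "z \<in> PP" for z using ab that by auto
    then show ?thesis using that[of a] ab(1) by blast
  next
    case False
    then have nri: "0 \<notin> rel_interior PP" using nint by (simp add: rel_interior_nonempty_interior)
    obtain a where a: "a \<noteq> 0" "\<And>y. y \<in> PP \<Longrightarrow> a \<bullet> 0 \<le> a \<bullet> y"
      by (rule supporting_hyperplane_rel_boundary[OF conv zero nri]) metis
    then show ?thesis using that[of "- a"] by simp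
  qed
  have "a \<bullet> u \<le> 0" if u: "u \<in> L" for u
  proof -
    obtain p where "awalk x p (sh u x)" using dn_walk[OF x sh_in[OF u x]] by blast
    then show ?thesis using closed_walk_bound_polytope[OF a(2) _ u, of x p] by simp
  qed
  then have "a \<bullet> u = 0" if "u \<in> L" for u
    using that uminus_in_lat[OF that] by (metis antisym inner_minus_right neg_le_0_iff_le)
  then have "orthogonal a a"
    by (intro orthogonal_to_span[of a L]) (simp_all add: span_lat orthogonal_def)
  then show False using a by (simp add: orthogonal_self)
qed

end

section \<open>The fan of a triangulated polytope\<close>

lemma representation_sum_basis:
  fixes V :: "'a::real_vector set"
  assumes "independent V" "finite V" "u \<in> V"
  shows "representation V (\<Sum>v\<in>V. c v *\<^sub>R v) u = c u"
proof -
  have "representation V (\<Sum>v\<in>V. c v *\<^sub>R v) = (\<lambda>v. if v \<in> V then c v else 0)"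
  proof (rule real_vector.representation_eqI[OF assms(1)])
    show "(\<Sum>v\<in>V. c v *\<^sub>R v) \<in> span V"
      by (intro span_sum span_scale span_base)
    have "{v. (if v \<in> V then c v else 0) \<noteq> 0} \<subseteq> V" by auto
    then show "finite {v. (if v \<in> V then c v else 0) \<noteq> 0}"
      using assms(2) finite_subset by blast
    have "(\<Sum>v | (if v \<in> V then c v else 0) \<noteq> 0. (if v \<in> V then c v else 0) *\<^sub>R v)
        = (\<Sum>v\<in>V. (if v \<in> V then c v else 0) *\<^sub>R v)"
      by (rule sum.mono_neutral_left) (use assms(2) in auto)
    then show "(\<Sum>v | (if v \<in> V then c v else 0) \<noteq> 0. (if v \<in> V then c v else 0) *\<^sub>R v) = (\<Sum>v\<in>V. c v *\<^sub>R v)"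
      by simp
  qed (auto split: if_splits)
  then show ?thesis using assms(3) by simp
qed

locale triangulated_polytope =
  fixes P :: "'a::euclidean_space set" and T :: "'a set \<Rightarrow> 'a set set"
  assumes polytope: "polytope P" and zero_int: "0 \<in> interior P"
    and triang: "\<And>\<sigma>. \<sigma> facet_of P \<Longrightarrow> triangulation_of (T \<sigma>) \<sigma>"
    and verts_sub: "\<And>\<sigma> \<Delta>. \<sigma> facet_of P \<Longrightarrow> \<Delta> \<in> T \<sigma> \<Longrightarrow> vertices_of \<Delta> \<subseteq> vertices_of \<sigma>"
begin

section \<open>Cells and coordinates in the basis of their vertices\<close>

definition cells :: "'a set set" where
  "cells = (\<Union>\<sigma>\<in>{\<sigma>. \<sigma> facet_of P}. T \<sigma>)"

definition crd :: "'a set \<Rightarrow> 'a \<Rightarrow> 'a \<Rightarrow> real" where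
  "crd \<Delta> w v = representation (vertices_of \<Delta>) w v"

lemma finite_cells: "finite cells"
  unfolding cells_def
  using finite_polytope_facets[OF polytope] triang by (auto simp: triangulation_of_def triangulation_def)

lemma aff_dim_P: "aff_dim P = int (DIM('a))"
  using zero_int aff_dim_nonempty_interior by blast

lemma affine_hull_P: "affine hull P = UNIV"
  using zero_int affine_hull_nonempty_interior by blast

text \<open>The right-hand side of a facet inequality can be scaled to 1 because 0 is interior,
  which makes it positive.\<close>

lemma facet_functional:
  assumes "\<sigma> facet_of P"
  obtains a where "\<And>x. x \<in> P \<Longrightarrow> a \<bullet> x \<le> 1" "\<sigma> = P \<inter> {x. a \<bullet> x = 1}"
proof -
  have "\<sigma> exposed_face_of P"
    using assms exposed_face_of_polyhedron[OF polytope_imp_polyhedron[OF polytope]]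
    by (simp add: facet_of_def)
  then obtain a b where ab: "P \<subseteq> {x. a \<bullet> x \<le> b}" "\<sigma> = P \<inter> {x. a \<bullet> x = b}"
    unfolding exposed_face_of_def by blast
  have ne: "\<sigma> \<noteq> {}" "\<sigma> \<noteq> P" using assms by (auto simp: facet_of_def)
  have "a \<noteq> 0" using ab ne by auto
  obtain r where r: "r > 0" "ball 0 r \<subseteq> P" using zero_int mem_interior by blast
  \<comment> \<open>A point of the ball around 0 in direction \<open>a\<close>, where the functional
    is positive; it forces b > 0.\<close>
  define y where "y = (r / 2 / norm a) *\<^sub>R a"
  have "norm y = r / 2" using \<open>a \<noteq> 0\<close> r by (simp add: y_def)
  then have "y \<in> P" using r by (intro subsetD[OF r(2)]) simp
  moreover have "a \<bullet> y > 0" using \<open>a \<noteq> 0\<close> r by (simp add: y_def)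
  ultimately have b: "b > 0" using ab(1) by fastforce
  show ?thesis
  proof (rule that[of "a /\<^sub>R b"])
    show "(a /\<^sub>R b) \<bullet> x \<le> 1" if "x \<in> P" for x
      using ab(1) that b by (auto simp: field_simps)
    show "\<sigma> = P \<inter> {x. (a /\<^sub>R b) \<bullet> x = 1}"
      using ab(2) b by (auto simp: field_simps)
  qed
qed

lemma cell:
  assumes "\<sigma> facet_of P" "\<Delta> \<in> T \<sigma>"
  shows "finite (vertices_of \<Delta>)" "\<not> affine_dependent (vertices_of \<Delta>)"
    "card (vertices_of \<Delta>) = DIM('a)"
    "\<Delta> = convex hull (vertices_of \<Delta>)" "vertices_of \<Delta> \<subseteq> \<sigma>" "vertices_of \<Delta> \<subseteq> vertices_of P"
proof -
  have "aff_dim \<sigma> = int (DIM('a)) - 1" using assms(1) aff_dim_P by (simp add: facet_of_def)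
  then have "(int (DIM('a)) - 1) simplex \<Delta>" using triang[OF assms(1)] assms(2) by (auto simp: triangulation_of_def)
  then obtain C where C: "\<not> affine_dependent C" "int (card C) = int (DIM('a))" "\<Delta> = convex hull C"
    unfolding simplex_def by auto
  have V: "vertices_of \<Delta> = C"
    unfolding vertices_of_def C(3) using extreme_point_of_convex_hull_affine_independent[OF C(1)] by auto
  show "\<not> affine_dependent (vertices_of \<Delta>)" "card (vertices_of \<Delta>) = DIM('a)"
    "\<Delta> = convex hull (vertices_of \<Delta>)" "finite (vertices_of \<Delta>)"
    using C aff_independent_finite unfolding V by auto
  show "vertices_of \<Delta> \<subseteq> \<sigma>" using verts_sub[OF assms] by (auto simp: vertices_of_def extreme_point_of_def)
  show "vertices_of \<Delta> \<subseteq> vertices_of P"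
    using verts_sub[OF assms] extreme_point_of_face[OF facet_of_imp_face_of[OF assms(1)]]
    by (auto simp: vertices_of_def)
qed

lemma cell_facet:
  assumes "\<Delta> \<in> cells"
  shows "\<exists>\<sigma> a. \<sigma> facet_of P \<and> \<Delta> \<in> T \<sigma> \<and> (\<forall>x\<in>P. a \<bullet> x \<le> 1) \<and> \<sigma> = P \<inter> {x. a \<bullet> x = 1} \<and>
    (\<forall>v\<in>vertices_of \<Delta>. a \<bullet> v = 1)"
proof -
  obtain \<sigma> where s: "\<sigma> facet_of P" "\<Delta> \<in> T \<sigma>" using assms by (auto simp: cells_def)
  show ?thesis
    by (rule facet_functional[OF s(1)]) (use s cell(5)[OF s] in blast)
qed

lemma finite_cell: "\<Delta> \<in> cells \<Longrightarrow> finite (vertices_of \<Delta>)"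
  and card_cell: "\<Delta> \<in> cells \<Longrightarrow> card (vertices_of \<Delta>) = DIM('a)"
  using cell(1,3) by (auto simp: cells_def)

lemma cell_verts: "\<Delta> \<in> cells \<Longrightarrow> vertices_of \<Delta> \<subseteq> vertices_of P"
  unfolding cells_def using cell(6) by blast

text \<open>The vertices lie on the hyperplane a \<bullet> x = 1, which misses 0. Applying
  \<open>a\<close> to a linear relation shows that its coefficients sum to 0, so it would be an
  affine relation.\<close>

lemma independent_cell:
  assumes "\<Delta> \<in> cells"
  shows "independent (vertices_of \<Delta>)"
proof
  assume "dependent (vertices_of \<Delta>)"
  then obtain u where u: "\<exists>v\<in>vertices_of \<Delta>. u v \<noteq> 0" "(\<Sum>v\<in>vertices_of \<Delta>. u v *\<^sub>R v) = 0"
    using dependent_finite[OF finite_cell[OF assms]] by blast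
  obtain \<sigma> a where s: "\<sigma> facet_of P" "\<Delta> \<in> T \<sigma>" and a: "\<forall>v\<in>vertices_of \<Delta>. a \<bullet> v = 1"
    using cell_facet[OF assms] by blast
  have "0 = a \<bullet> (\<Sum>v\<in>vertices_of \<Delta>. u v *\<^sub>R v)" using u(2) by simp
  also have "\<dots> = (\<Sum>v\<in>vertices_of \<Delta>. u v)" using a by (simp add: inner_sum_right)
  finally have "affine_dependent (vertices_of \<Delta>)"
    using u affine_dependent_explicit_finite[OF finite_cell[OF assms]] by auto
  then show False using cell(2)[OF s] by simp
qed

lemma span_cell:
  assumes "\<Delta> \<in> cells"
  shows "span (vertices_of \<Delta>) = UNIV"
proof -
  have "(UNIV :: 'a set) \<subseteq> span (vertices_of \<Delta>)"
    by (rule card_ge_dim_independent) (use assms in \<open>auto simp: independent_cell card_cell\<close>)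
  then show ?thesis by blast
qed

lemma crd_sum: "\<Delta> \<in> cells \<Longrightarrow> (\<Sum>v\<in>vertices_of \<Delta>. crd \<Delta> w v *\<^sub>R v) = w"
  unfolding crd_def
  by (rule real_vector.sum_representation_eq) (auto simp: independent_cell span_cell finite_cell)

lemma crd_of_sum: "\<Delta> \<in> cells \<Longrightarrow> u \<in> vertices_of \<Delta> \<Longrightarrow> crd \<Delta> (\<Sum>v\<in>vertices_of \<Delta>. c v *\<^sub>R v) u = c u"
  unfolding crd_def by (rule representation_sum_basis) (auto simp: independent_cell finite_cell)

lemma crd_add: "\<Delta> \<in> cells \<Longrightarrow> crd \<Delta> (w + w') v = crd \<Delta> w v + crd \<Delta> w' v"
  unfolding crd_def by (simp add: real_vector.representation_add independent_cell span_cell)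

lemma crd_diff: "\<Delta> \<in> cells \<Longrightarrow> crd \<Delta> (w - w') v = crd \<Delta> w v - crd \<Delta> w' v"
  unfolding crd_def by (simp add: real_vector.representation_diff independent_cell span_cell)

lemma crd_minus: "\<Delta> \<in> cells \<Longrightarrow> crd \<Delta> (- w) v = - crd \<Delta> w v"
  using crd_diff[of \<Delta> 0 w v] crd_diff[of \<Delta> 0 0 v] by simp

lemma crd_scale: "\<Delta> \<in> cells \<Longrightarrow> crd \<Delta> (r *\<^sub>R w) v = r * crd \<Delta> w v"
  unfolding crd_def by (simp add: real_vector.representation_scale independent_cell span_cell)

text \<open>The ray from 0 through \<open>w\<close> leaves the polytope in a facet, whose
  triangulation provides the cell. For w = 0 any cell serves.\<close>

lemma cells_cover: "\<exists>\<Delta>\<in>cells. \<forall>v\<in>vertices_of \<Delta>. crd \<Delta> w v \<ge> 0"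
proof (cases "w = 0")
  case True
  obtain \<sigma> where s: "\<sigma> facet_of P"
    using polytope_facet_exists[OF polytope] aff_dim_P by auto
  then obtain \<Delta> where "\<Delta> \<in> T \<sigma>"
    using triang[OF s] by (auto simp: triangulation_of_def facet_of_def)
  then have "\<Delta> \<in> cells" using s by (auto simp: cells_def)
  then show ?thesis using True crd_scale[of \<Delta> 0 0] by (intro bexI[of _ \<Delta>]) auto
next
  case False
  obtain r where r: "r > 0" "0 + r *\<^sub>R w \<in> frontier P"
    by (rule ray_to_frontier[OF polytope_imp_bounded[OF polytope] zero_int False])
  have "rel_frontier P = frontier P" by (rule rel_frontier_frontier[OF affine_hull_P])
  then have "r *\<^sub>R w \<in> \<Union>{F. F facet_of P}"
    using r rel_frontier_of_polyhedron[OF polytope_imp_polyhedron[OF polytope]] by simp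
  then obtain \<sigma> where s: "\<sigma> facet_of P" "r *\<^sub>R w \<in> \<sigma>" by blast
  then obtain \<Delta> where D: "\<Delta> \<in> T \<sigma>" "r *\<^sub>R w \<in> \<Delta>"
    using triang[OF s(1)] by (auto simp: triangulation_of_def)
  then have cells: "\<Delta> \<in> cells" using s by (auto simp: cells_def)
  have "r *\<^sub>R w \<in> convex hull (vertices_of \<Delta>)" using D cell(4)[OF s(1) D(1)] by simp
  then obtain c where c: "\<And>v. v \<in> vertices_of \<Delta> \<Longrightarrow> c v \<ge> 0" "(\<Sum>v\<in>vertices_of \<Delta>. c v *\<^sub>R v) = r *\<^sub>R w"
    using convex_hull_finite[OF finite_cell[OF cells]] by auto
  have "crd \<Delta> w v \<ge> 0" if v: "v \<in> vertices_of \<Delta>" for v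
  proof -
    have "r * crd \<Delta> w v = c v" using crd_of_sum[OF cells v, of c] c(2) crd_scale[OF cells] by simp
    then show ?thesis using c(1)[OF v] r by (simp add: zero_le_mult_iff[of r] flip: \<open>r * crd \<Delta> w v = c v\<close>)
  qed
  then show ?thesis using cells by blast
qed

text \<open>Over the cone of a cell its own facet functional dominates all others, so
  \<open>a\<close> and \<open>a'\<close> have the same value at \<open>w\<close>. As all coordinates
  are positive, equality forces \<open>a'\<close> to be 1 at each vertex of \<Delta>, whence a = a'
  and both cells lie in one facet. There the rescaled \<open>w\<close> is a relative interior point
  of two simplices that meet in a common face.\<close>

lemma cells_disjoint:
  assumes c1: "\<Delta> \<in> cells" and c2: "\<Delta>' \<in> cells"
    and p1: "\<And>v. v \<in> vertices_of \<Delta> \<Longrightarrow> crd \<Delta> w v > 0"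
    and p2: "\<And>v. v \<in> vertices_of \<Delta>' \<Longrightarrow> crd \<Delta>' w v > 0"
  shows "\<Delta> = \<Delta>'"
proof -
  obtain \<sigma> a where s: "\<sigma> facet_of P" "\<Delta> \<in> T \<sigma>" and aP: "\<forall>x\<in>P. a \<bullet> x \<le> 1"
    and sig: "\<sigma> = P \<inter> {x. a \<bullet> x = 1}" and av: "\<forall>v\<in>vertices_of \<Delta>. a \<bullet> v = 1"
    using cell_facet[OF c1] by blast
  obtain \<sigma>' a' where s': "\<sigma>' facet_of P" "\<Delta>' \<in> T \<sigma>'" and aP': "\<forall>x\<in>P. a' \<bullet> x \<le> 1"
    and sig': "\<sigma>' = P \<inter> {x. a' \<bullet> x = 1}" and av': "\<forall>v\<in>vertices_of \<Delta>'. a' \<bullet> v = 1"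
    using cell_facet[OF c2] by blast
  have VP: "vertices_of \<Delta> \<subseteq> P" "vertices_of \<Delta>' \<subseteq> P"
    using cell(5)[OF s] cell(5)[OF s'] sig sig' by auto
  have aw: "a \<bullet> w = (\<Sum>v\<in>vertices_of \<Delta>. crd \<Delta> w v)"
    by (subst (1) crd_sum[OF c1, symmetric]) (simp add: inner_sum_right av)
  have aw': "a' \<bullet> w = (\<Sum>v\<in>vertices_of \<Delta>'. crd \<Delta>' w v)"
    by (subst (1) crd_sum[OF c2, symmetric]) (simp add: inner_sum_right av')
  have le1: "a' \<bullet> w \<le> a \<bullet> w"
  proof -
    have "a' \<bullet> w = (\<Sum>v\<in>vertices_of \<Delta>. crd \<Delta> w v * (a' \<bullet> v))"
      by (subst (1) crd_sum[OF c1, symmetric]) (simp add: inner_sum_right)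
    also have "\<dots> \<le> (\<Sum>v\<in>vertices_of \<Delta>. crd \<Delta> w v * 1)"
      by (intro sum_mono mult_left_mono) (use p1 aP' VP in \<open>auto simp: less_imp_le\<close>)
    finally show ?thesis using aw by simp
  qed
  have le2: "a \<bullet> w \<le> a' \<bullet> w"
  proof -
    have "a \<bullet> w = (\<Sum>v\<in>vertices_of \<Delta>'. crd \<Delta>' w v * (a \<bullet> v))"
      by (subst (1) crd_sum[OF c2, symmetric]) (simp add: inner_sum_right)
    also have "\<dots> \<le> (\<Sum>v\<in>vertices_of \<Delta>'. crd \<Delta>' w v * 1)"
      by (intro sum_mono mult_left_mono) (use p2 aP VP in \<open>auto simp: less_imp_le\<close>)
    finally show ?thesis using aw' by simp
  qed
  have eq: "a \<bullet> w = a' \<bullet> w" using le1 le2 by simp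
  have "a' \<bullet> v = 1" if v: "v \<in> vertices_of \<Delta>" for v
  proof -
    have "(\<Sum>v\<in>vertices_of \<Delta>. crd \<Delta> w v * (1 - a' \<bullet> v)) = a \<bullet> w - a' \<bullet> (\<Sum>v\<in>vertices_of \<Delta>. crd \<Delta> w v *\<^sub>R v)"
      by (simp add: aw inner_sum_right sum_subtractf right_diff_distrib)
    then have sum0: "(\<Sum>v\<in>vertices_of \<Delta>. crd \<Delta> w v * (1 - a' \<bullet> v)) = 0"
      using crd_sum[OF c1] eq by simp
    have ge0: "crd \<Delta> w v * (1 - a' \<bullet> v) \<ge> 0" if "v \<in> vertices_of \<Delta>" for v
      using p1[OF that] aP' VP that by (auto intro!: mult_nonneg_nonneg simp: less_imp_le)
    have "crd \<Delta> w v * (1 - a' \<bullet> v) = 0"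
      using sum_nonneg_0[OF finite_cell[OF c1] ge0 sum0 v] .
    then show ?thesis using p1[OF v] by simp
  qed
  then have "orthogonal (a - a') y" for y
    by (intro orthogonal_to_span[of y "vertices_of \<Delta>"])
      (auto simp: span_cell[OF c1] orthogonal_def inner_diff_left av)
  then have "a = a'" by (metis orthogonal_self eq_iff_diff_eq_0)
  then have s'': "\<Delta>' \<in> T \<sigma>" using sig sig' s' by simp
  define r where "r = a \<bullet> w"
  have ne: "vertices_of \<Delta> \<noteq> {}" using card_cell[OF c1] by auto
  have r: "r > 0" unfolding r_def aw by (rule sum_pos[OF finite_cell[OF c1] ne p1])
  have mem: "w /\<^sub>R r \<in> rel_interior D"
    if D: "D \<in> cells" "D \<in> T \<sigma>" and pos: "\<And>v. v \<in> vertices_of D \<Longrightarrow> crd D w v > 0"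
      and sum: "(\<Sum>v\<in>vertices_of D. crd D w v) = r" for D
  proof -
    have "w /\<^sub>R r \<in> rel_interior (convex hull (vertices_of D))"
      unfolding rel_interior_convex_hull_explicit[OF cell(2)[OF s(1) D(2)]]
    proof (rule CollectI, intro exI conjI ballI)
      show "0 < crd D w v / r" if "v \<in> vertices_of D" for v using pos[OF that] r by simp
      show "(\<Sum>v\<in>vertices_of D. crd D w v / r) = 1" using sum r by (simp flip: sum_divide_distrib)
      have "(\<Sum>v\<in>vertices_of D. (crd D w v / r) *\<^sub>R v) = (\<Sum>v\<in>vertices_of D. crd D w v *\<^sub>R v) /\<^sub>R r"
        by (simp add: scaleR_sum_right divide_inverse mult.commute)
      then show "(\<Sum>v\<in>vertices_of D. (crd D w v / r) *\<^sub>R v) = w /\<^sub>R r" using crd_sum[OF D(1)] by simp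
    qed
    then show ?thesis using cell(4)[OF s(1) D(2)] by simp
  qed
  have m1: "w /\<^sub>R r \<in> rel_interior \<Delta>" using mem[OF c1 s(2) p1] aw by (simp add: r_def)
  have m2: "w /\<^sub>R r \<in> rel_interior \<Delta>'" using mem[OF c2 s'' p2] aw' eq by (simp add: r_def)
  have f: "\<Delta> \<inter> \<Delta>' face_of \<Delta>" "\<Delta>' \<inter> \<Delta> face_of \<Delta>'"
    using triang[OF s(1)] s(2) s'' by (auto simp: triangulation_of_def triangulation_def)
  have "\<Delta> \<inter> \<Delta>' = \<Delta>" 
    using face_of_disjoint_rel_interior[OF f(1)] m1 m2 rel_interior_subset by blast
  moreover have "\<Delta>' \<inter> \<Delta> = \<Delta>'" 
    using face_of_disjoint_rel_interior[OF f(2)] m1 m2 rel_interior_subset by blast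
  ultimately show ?thesis by blast
qed

section \<open>Half-open cones of a generic vector\<close>

lemma generic_vector: "\<exists>\<xi>. \<forall>\<Delta>\<in>cells. \<forall>v\<in>vertices_of \<Delta>. crd \<Delta> \<xi> v \<noteq> 0"
proof -
  have neg: "negligible {w. crd \<Delta> w v = 0}" if D: "\<Delta> \<in> cells" and v: "v \<in> vertices_of \<Delta>" for \<Delta> v
  proof -
    have lin: "linear (\<lambda>w. crd \<Delta> w v)"
      by (rule linearI) (simp_all add: crd_add crd_scale D)
    obtain b where b: "\<And>w. crd \<Delta> w v = b \<bullet> w"
      by (rule that[of "adjoint (\<lambda>w. crd \<Delta> w v) 1"])
        (use adjoint_works[OF lin, of _ 1] in \<open>simp add: inner_commute\<close>)
    have "crd \<Delta> v v = 1" unfolding crd_def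
      using real_vector.representation_basis[OF independent_cell[OF D] v] by simp
    then have "b \<noteq> 0" using b by auto
    then show ?thesis unfolding b by (intro negligible_hyperplane) simp
  qed
  have "negligible (\<Union>\<Delta>\<in>cells. \<Union>v\<in>vertices_of \<Delta>. {w. crd \<Delta> w v = 0})"
    using neg by (intro negligible_Union) (auto simp: finite_cells finite_cell intro!: negligible_Union)
  then have "(\<Union>\<Delta>\<in>cells. \<Union>v\<in>vertices_of \<Delta>. {w. crd \<Delta> w v = 0}) \<noteq> UNIV"
    using non_negligible_UNIV by metis
  then show ?thesis by blast
qed

text \<open>Equivalently, w + \<epsilon> * \<xi> lies in the open cone of the cell for all small
  \<epsilon> > 0.\<close>

definition half_open_cone :: "'a \<Rightarrow> 'a set \<Rightarrow> 'a set" where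
  "half_open_cone \<xi> \<Delta> =
     {w. \<forall>v\<in>vertices_of \<Delta>. crd \<Delta> w v > 0 \<or> crd \<Delta> w v = 0 \<and> crd \<Delta> \<xi> v > 0}"

text \<open>Existence applies \<open>cells_cover\<close> and uniqueness
  \<open>cells_disjoint\<close> to \<open>w\<close> perturbed along \<xi>. Only finitely many
  coordinates occur, so one \<epsilon> suits them all; genericity excludes a coordinate that
  vanishes for both \<open>w\<close> and \<xi>.\<close>

lemma half_open_cone_partition:
  assumes gen: "\<And>\<Delta> v. \<Delta> \<in> cells \<Longrightarrow> v \<in> vertices_of \<Delta> \<Longrightarrow> crd \<Delta> \<xi> v \<noteq> 0"
  shows "\<exists>!\<Delta>. \<Delta> \<in> cells \<and> w \<in> half_open_cone \<xi> \<Delta>"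
proof -
  have ev1: "eventually (\<lambda>\<epsilon>. \<forall>\<Delta>\<in>cells. \<forall>v\<in>vertices_of \<Delta>. crd \<Delta> (w + \<epsilon> *\<^sub>R \<xi>) v \<ge> 0 \<longrightarrow>
      crd \<Delta> w v > 0 \<or> crd \<Delta> w v = 0 \<and> crd \<Delta> \<xi> v > 0) (at_right (0::real))"
    (is "eventually (\<lambda>\<epsilon>. \<forall>\<Delta>\<in>cells. \<forall>v\<in>vertices_of \<Delta>. ?P \<epsilon> \<Delta> v) _")
  proof -
    have "eventually (\<lambda>\<epsilon>. ?P \<epsilon> \<Delta> v) (at_right 0)" if D: "\<Delta> \<in> cells" and v: "v \<in> vertices_of \<Delta>" for \<Delta> v
    proof -
      consider "crd \<Delta> w v > 0" | "crd \<Delta> w v < 0" | "crd \<Delta> w v = 0" by linarith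
      then show ?thesis
      proof cases
        case 2
        have "((\<lambda>\<epsilon>. crd \<Delta> w v + \<epsilon> * crd \<Delta> \<xi> v) \<longlongrightarrow> crd \<Delta> w v + 0 * crd \<Delta> \<xi> v) (at_right 0)"
          by (intro tendsto_intros)
        then have "eventually (\<lambda>\<epsilon>. crd \<Delta> w v + \<epsilon> * crd \<Delta> \<xi> v < 0) (at_right 0)"
          using 2 by (intro order_tendstoD(2)) auto
        then show ?thesis by eventually_elim (auto simp: crd_add crd_scale D)
      next
        case 3
        have "eventually (\<lambda>\<epsilon>::real. \<epsilon> > 0) (at_right 0)" by (simp add: eventually_at_right_less)
        then show ?thesis
          by eventually_elim (use 3 gen[OF D v] in \<open>auto simp: crd_add crd_scale D zero_le_mult_iff\<close>)
      qed auto
    qed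
    then show ?thesis by (simp add: eventually_ball_finite_distrib finite_cells finite_cell)
  qed
  then obtain \<epsilon> :: real where e: "\<forall>\<Delta>\<in>cells. \<forall>v\<in>vertices_of \<Delta>. ?P \<epsilon> \<Delta> v"
    using eventually_happens'[OF trivial_limit_at_right_real] by blast
  obtain \<Delta> where D: "\<Delta> \<in> cells" "\<forall>v\<in>vertices_of \<Delta>. crd \<Delta> (w + \<epsilon> *\<^sub>R \<xi>) v \<ge> 0"
    using cells_cover by blast
  have D': "w \<in> half_open_cone \<xi> \<Delta>" using e D by (auto simp: half_open_cone_def)
  have uniq: "\<Delta>1 = \<Delta>2" if c: "\<Delta>1 \<in> cells" "\<Delta>2 \<in> cells"
    and h: "w \<in> half_open_cone \<xi> \<Delta>1" "w \<in> half_open_cone \<xi> \<Delta>2" for \<Delta>1 \<Delta>2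
  proof -
    have ev: "eventually (\<lambda>\<epsilon>. \<forall>v\<in>vertices_of \<Delta>. crd \<Delta> (w + \<epsilon> *\<^sub>R \<xi>) v > 0) (at_right (0::real))"
      if D: "\<Delta> \<in> cells" and h: "w \<in> half_open_cone \<xi> \<Delta>" for \<Delta>
    proof -
      have "eventually (\<lambda>\<epsilon>. crd \<Delta> (w + \<epsilon> *\<^sub>R \<xi>) v > 0) (at_right (0::real))" if v: "v \<in> vertices_of \<Delta>" for v
      proof (cases "crd \<Delta> w v > 0")
        case True
        have "((\<lambda>\<epsilon>. crd \<Delta> w v + \<epsilon> * crd \<Delta> \<xi> v) \<longlongrightarrow> crd \<Delta> w v + 0 * crd \<Delta> \<xi> v) (at_right 0)"
          by (intro tendsto_intros)
        then have "eventually (\<lambda>\<epsilon>. crd \<Delta> w v + \<epsilon> * crd \<Delta> \<xi> v > 0) (at_right 0)"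
          using True by (intro order_tendstoD(1)) auto
        then show ?thesis by eventually_elim (auto simp: crd_add crd_scale D)
      next
        case False
        then have 0: "crd \<Delta> w v = 0" "crd \<Delta> \<xi> v > 0" using h v by (auto simp: half_open_cone_def)
        have "eventually (\<lambda>\<epsilon>::real. \<epsilon> > 0) (at_right 0)" by (simp add: eventually_at_right_less)
        then show ?thesis by eventually_elim (use 0 in \<open>auto simp: crd_add crd_scale D\<close>)
      qed
      then show ?thesis by (simp add: eventually_ball_finite_distrib finite_cell D)
    qed
    have "eventually (\<lambda>\<epsilon>. (\<forall>v\<in>vertices_of \<Delta>1. crd \<Delta>1 (w + \<epsilon> *\<^sub>R \<xi>) v > 0) \<and>
        (\<forall>v\<in>vertices_of \<Delta>2. crd \<Delta>2 (w + \<epsilon> *\<^sub>R \<xi>) v > 0)) (at_right (0::real))"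
      using ev[OF c(1) h(1)] ev[OF c(2) h(2)] by (rule eventually_conj)
    then obtain \<epsilon> :: real where "\<forall>v\<in>vertices_of \<Delta>1. crd \<Delta>1 (w + \<epsilon> *\<^sub>R \<xi>) v > 0"
        "\<forall>v\<in>vertices_of \<Delta>2. crd \<Delta>2 (w + \<epsilon> *\<^sub>R \<xi>) v > 0"
      using eventually_happens'[OF trivial_limit_at_right_real] by blast
    then show ?thesis using cells_disjoint[OF c] by blast
  qed
  show ?thesis using D(1) D' uniq by blast
qed

end

section \<open>Distances in a well-arranged graph\<close>

locale well_arranged = connected_periodic \<Gamma> n
  for \<Gamma> :: "('v, 'e, 'a::euclidean_space) pgraph" and n :: nat +
  fixes \<Phi> :: "'v \<Rightarrow> 'a" and x0 :: 'v and d :: "'a \<Rightarrow> nat" and T :: "'a set \<Rightarrow> 'a set set"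
  assumes realization: "periodic_realization \<Gamma> \<Phi>" and x0: "x0 \<in> VV"
    and arranged: "well_arranged_by \<Gamma> \<Phi> x0 d T"
begin

sublocale triangulated_polytope PP T
proof
  show "polytope PP" by (rule polytope_growth)
  show "0 \<in> interior PP" using x0 by (intro zero_in_interior) auto
qed (use arranged in \<open>auto simp: well_arranged_by_def\<close>)

section \<open>Positions, lengths of lattice vectors and the box condition\<close>

definition pos :: "'v \<Rightarrow> 'a" where "pos y = \<Phi> y - \<Phi> x0"

definition D :: "'v \<Rightarrow> nat" where "D y = dn x0 y"

definition mult_sum :: "'a set \<Rightarrow> ('a \<Rightarrow> nat) \<Rightarrow> 'a" where
  "mult_sum A k = (\<Sum>v\<in>A. real (k v * d v) *\<^sub>R v)"

lemma pos_sh: "u \<in> L \<Longrightarrow> y \<in> VV \<Longrightarrow> pos (sh u y) = pos y + u"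
  using realization by (simp add: pos_def periodic_realization_def)

lemma d_pos: "\<Delta> \<in> cells \<Longrightarrow> v \<in> vertices_of \<Delta> \<Longrightarrow> d v > 0"
  using arranged cell_verts unfolding well_arranged_by_def by blast

lemma mult_in_lat: "\<Delta> \<in> cells \<Longrightarrow> v \<in> vertices_of \<Delta> \<Longrightarrow> real (k * d v) *\<^sub>R v \<in> L"
proof -
  assume "\<Delta> \<in> cells" "v \<in> vertices_of \<Delta>"
  then have "real (d v) *\<^sub>R v \<in> L"
    using arranged cell_verts unfolding well_arranged_by_def by blast
  then show ?thesis using nat_scale_in_lat[of "real (d v) *\<^sub>R v" k] by simp
qed

lemma mult_sum_in_lat: "\<Delta> \<in> cells \<Longrightarrow> A \<subseteq> vertices_of \<Delta> \<Longrightarrow> mult_sum A k \<in> L"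
  unfolding mult_sum_def by (rule sum_in_lat) (use mult_in_lat in blast)

lemma arranged_dist:
  assumes "\<Delta> \<in> cells" "V' \<subseteq> vertices_of \<Delta>" "y \<in> VV" "pos y \<in> half_open_box d V'"
  shows "D y + dn y (sh (mult_sum V' (\<lambda>_. 1)) x0) = (\<Sum>v\<in>V'. d v)"
proof -
  obtain \<sigma> where s: "\<sigma> facet_of PP" "\<Delta> \<in> T \<sigma>" using assms(1) by (auto simp: cells_def)
  have z: "mult_sum V' (\<lambda>_. 1) = (\<Sum>v\<in>V'. real (d v) *\<^sub>R v)" by (simp add: mult_sum_def)
  have "gdist \<Gamma> x0 y + gdist \<Gamma> y (sh (mult_sum V' (\<lambda>_. 1)) x0) = enat (\<Sum>v\<in>V'. d v)"
    using arranged s assms(2-4) unfolding well_arranged_by_def Let_def z pos_def by blast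
  then show ?thesis
    using x0 assms(3) mult_sum_in_lat[OF assms(1,2)] by (simp add: gdist_eq_dn D_def sh_in)
qed

lemma length_add:
  assumes "u \<in> L" "u' \<in> L"
  shows "dn x0 (sh (u + u') x0) \<le> dn x0 (sh u x0) + dn x0 (sh u' x0)"
proof -
  have "dn x0 (sh (u + u') x0) \<le> dn x0 (sh u x0) + dn (sh u x0) (sh u (sh u' x0))"
    using assms x0 dn_triangle[of x0 "sh u x0" "sh u (sh u' x0)"] by (simp add: sh_in sh_add add_in_lat)
  then show ?thesis using assms x0 by (simp add: dn_sh sh_in)
qed

text \<open>The condition for V' = {v} and y = x0 bounds the length of a single step by
  \<open>d v\<close>; subadditivity does the rest.\<close>

lemma length_mult_le:
  assumes "\<Delta> \<in> cells" "v \<in> vertices_of \<Delta>"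
  shows "dn x0 (sh (real (k * d v) *\<^sub>R v) x0) \<le> k * d v"
proof (induction k)
  case 0
  then show ?case using x0 by (simp add: sh_0 dn_self)
next
  case (Suc k)
  have "0 \<in> half_open_box d {v}"
    using d_pos[OF assms] by (auto simp: half_open_box_def intro!: exI[of _ "\<lambda>_. 0"])
  then have "dn x0 (sh (real (1 * d v) *\<^sub>R v) x0) \<le> d v"
    using arranged_dist[OF assms(1), of "{v}" x0] assms(2) x0 by (simp add: pos_def mult_sum_def)
  moreover have "real (Suc k * d v) *\<^sub>R v = real (1 * d v) *\<^sub>R v + real (k * d v) *\<^sub>R v"
    by (simp add: algebra_simps)
  ultimately show ?case
    using Suc length_add[OF mult_in_lat[OF assms] mult_in_lat[OF assms], of 1 k] by simp
qed

lemma length_mult_sum_le: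
  assumes "\<Delta> \<in> cells" "A \<subseteq> vertices_of \<Delta>"
  shows "dn x0 (sh (mult_sum A k) x0) \<le> (\<Sum>v\<in>A. k v * d v)"
proof -
  have "finite A" using assms finite_cell finite_subset by blast
  then show ?thesis using assms(2)
  proof (induction A)
    case empty
    then show ?case using x0 by (simp add: mult_sum_def sh_0 dn_self)
  next
    case (insert v A)
    then have v: "v \<in> vertices_of \<Delta>" and A: "A \<subseteq> vertices_of \<Delta>" by auto
    have "mult_sum (insert v A) k = real (k v * d v) *\<^sub>R v + mult_sum A k"
      using insert by (simp add: mult_sum_def)
    then show ?case
      using length_add[OF mult_in_lat[OF assms(1) v] mult_sum_in_lat[OF assms(1) A], of "k v" k]
        length_mult_le[OF assms(1) v, of "k v"] insert.IH[OF A] insert.hyps by simp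
  qed
qed

text \<open>The facet functional is 1 at all vertices of the cell. Together with
  \<open>length_mult_sum_le\<close>, lengths are thus additive within the cone.\<close>

lemma length_mult_sum_ge:
  assumes "\<Delta> \<in> cells"
  shows "(\<Sum>v\<in>vertices_of \<Delta>. k v * d v) \<le> dn x0 (sh (mult_sum (vertices_of \<Delta>) k) x0)"
proof -
  obtain a where a: "\<forall>x\<in>PP. a \<bullet> x \<le> 1" "\<forall>v\<in>vertices_of \<Delta>. a \<bullet> v = 1"
    using cell_facet[OF assms] by blast
  have "real (\<Sum>v\<in>vertices_of \<Delta>. k v * d v) = a \<bullet> mult_sum (vertices_of \<Delta>) k"
    using a(2) by (simp add: mult_sum_def inner_sum_right)
  also have "\<dots> \<le> real (dn x0 (sh (mult_sum (vertices_of \<Delta>) k) x0))"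
    by (rule dn_bound) (use a x0 mult_sum_in_lat[OF assms] in auto)
  finally show ?thesis by linarith
qed

lemma crd_mult_sum: "\<Delta> \<in> cells \<Longrightarrow> v \<in> vertices_of \<Delta> \<Longrightarrow> crd \<Delta> (mult_sum (vertices_of \<Delta>) k) v = real (k v * d v)"
  unfolding mult_sum_def by (rule crd_of_sum)

lemma crd_mult:
  assumes "\<Delta> \<in> cells" "v \<in> vertices_of \<Delta>" "u \<in> vertices_of \<Delta>"
  shows "crd \<Delta> (r *\<^sub>R v) u = (if u = v then r else 0)"
  using assms real_vector.representation_basis[OF independent_cell[OF assms(1)] assms(2)]
  by (simp add: crd_scale) (simp add: crd_def)

text \<open>Extends the defining condition from half-open boxes with sides \<open>d v\<close> to closed boxes whose
  sides are multiples of \<open>d v\<close>; the lower bound comes from the supporting functional of the facet.\<close>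

lemma box_dist:
  assumes D: "\<Delta> \<in> cells" and y: "y \<in> VV"
    and c: "\<And>v. v \<in> vertices_of \<Delta> \<Longrightarrow> 0 \<le> crd \<Delta> (pos y) v \<and> crd \<Delta> (pos y) v \<le> real (K v * d v)"
  shows "D y + D (sh (- mult_sum (vertices_of \<Delta>) K) y) = (\<Sum>v\<in>vertices_of \<Delta>. K v * d v)"
proof -
  let ?V = "vertices_of \<Delta>"
  \<comment> \<open>The number of whole steps \<open>d v\<close> below the coordinate; the remainder
    lies in [0, d v).\<close>
  define k where "k v = nat \<lfloor>crd \<Delta> (pos y) v / real (d v)\<rfloor>" for v
  have kc: "real (k v * d v) \<le> crd \<Delta> (pos y) v" "crd \<Delta> (pos y) v < real (k v * d v) + real (d v)" "k v \<le> K v"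
    if v: "v \<in> ?V" for v
  proof -
    have dv: "real (d v) > 0" using d_pos[OF D v] by simp
    have "0 \<le> crd \<Delta> (pos y) v / real (d v)" using c[OF v] dv by simp
    then have kk: "real (k v) = of_int \<lfloor>crd \<Delta> (pos y) v / real (d v)\<rfloor>" by (simp add: k_def)
    have "real (k v) \<le> crd \<Delta> (pos y) v / real (d v)" unfolding kk by simp
    then show "real (k v * d v) \<le> crd \<Delta> (pos y) v" using dv by (simp add: field_simps)
    have "crd \<Delta> (pos y) v / real (d v) < real (k v) + 1" unfolding kk by linarith
    then show "crd \<Delta> (pos y) v < real (k v * d v) + real (d v)" using dv by (simp add: field_simps)
    have "real (k v * d v) \<le> real (K v * d v)"
      using \<open>real (k v * d v) \<le> crd \<Delta> (pos y) v\<close> c[OF v] by linarith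
    then show "k v \<le> K v" using dv by (simp flip: of_nat_mult)
  qed
  \<comment> \<open>Directions with room for one more step. In the others \<open>k v = K v\<close>,
    so the coordinate sits at the closed end of the box and leaves no remainder.\<close>
  define V' where "V' = {v \<in> ?V. k v < K v}"
  have V': "V' \<subseteq> ?V" by (auto simp: V'_def)
  \<comment> \<open>The way from x0 to the far corner is split into U, the full steps before the
    small box containing y, then Z across this box, then W for the steps after it.\<close>
  define U where "U = mult_sum ?V k"
  define Z where "Z = mult_sum V' (\<lambda>_. 1)"
  define k2 where "k2 v = K v - k v - (if v \<in> V' then 1 else 0)" for v
  define W where "W = mult_sum ?V k2"
  have U: "U \<in> L" and Z: "Z \<in> L" and W: "W \<in> L"
    unfolding U_def Z_def W_def using mult_sum_in_lat[OF D] V' by auto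
  have k2: "k v + k2 v + (if v \<in> V' then 1 else 0) = K v" if "v \<in> ?V" for v
    using kc(3)[OF that] that by (auto simp: k2_def V'_def)
  have Zeq: "Z = (\<Sum>v\<in>?V. real ((if v \<in> V' then 1 else 0) * d v) *\<^sub>R v)"
    unfolding Z_def mult_sum_def
    by (rule sum.mono_neutral_cong_left) (use V' finite_cell[OF D] in auto)
  have sumd: "(\<Sum>v\<in>V'. d v) = (\<Sum>v\<in>?V. (if v \<in> V' then 1 else 0) * d v)"
    by (rule sum.mono_neutral_cong_left) (use V' finite_cell[OF D] in auto)
  have UZW: "U + Z + W = mult_sum ?V K"
  proof -
    have "U + Z + W = (\<Sum>v\<in>?V. real ((k v + k2 v + (if v \<in> V' then 1 else 0)) * d v) *\<^sub>R v)"
      unfolding U_def W_def Zeq mult_sum_def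
      by (simp only: sum.distrib[symmetric] scaleR_add_left[symmetric] of_nat_add[symmetric]
          distrib_right[symmetric] add.assoc add.commute[of "if _ \<in> V' then 1 else 0"])
    also have "\<dots> = mult_sum ?V K" unfolding mult_sum_def by (rule sum.cong) (simp_all add: k2)
    finally show ?thesis .
  qed
  have total: "(\<Sum>v\<in>?V. k v * d v) + (\<Sum>v\<in>V'. d v) + (\<Sum>v\<in>?V. k2 v * d v) = (\<Sum>v\<in>?V. K v * d v)"
  proof -
    have "(\<Sum>v\<in>?V. k v * d v) + (\<Sum>v\<in>V'. d v) + (\<Sum>v\<in>?V. k2 v * d v)
        = (\<Sum>v\<in>?V. (k v + k2 v + (if v \<in> V' then 1 else 0)) * d v)"
      unfolding sumd distrib_right sum.distrib by simp
    also have "\<dots> = (\<Sum>v\<in>?V. K v * d v)" by (rule sum.cong) (simp_all add: k2)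
    finally show ?thesis .
  qed
  define y0 where "y0 = sh (- U) y"
  have y0: "y0 \<in> VV" and yy0: "y = sh U y0"
    using y U by (simp_all add: y0_def sh_in uminus_in_lat sh_add sh_0)
  have "pos y0 \<in> half_open_box d V'"
    unfolding half_open_box_def
  proof (rule CollectI, intro exI conjI)
    show "\<forall>v\<in>V'. 0 \<le> crd \<Delta> (pos y) v - real (k v * d v) \<and> crd \<Delta> (pos y) v - real (k v * d v) < real (d v)"
      using kc V' by (auto simp: less_diff_eq diff_less_eq add.commute)
    have "pos y0 = pos y - U" using U y by (simp add: y0_def pos_sh uminus_in_lat)
    also have "\<dots> = (\<Sum>v\<in>?V. crd \<Delta> (pos y) v *\<^sub>R v) - U" using crd_sum[OF D] by simp
    also have "\<dots> = (\<Sum>v\<in>?V. (crd \<Delta> (pos y) v - real (k v * d v)) *\<^sub>R v)"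
      unfolding U_def mult_sum_def by (simp add: sum_subtractf scaleR_diff_left)
    also have "\<dots> = (\<Sum>v\<in>V'. (crd \<Delta> (pos y) v - real (k v * d v)) *\<^sub>R v)"
    proof (rule sum.mono_neutral_right[OF finite_cell[OF D] V'], rule ballI)
      fix v assume v: "v \<in> ?V - V'"
      then have "k v = K v" using kc(3) by (fastforce simp: V'_def)
      then have "crd \<Delta> (pos y) v = real (k v * d v)"
        using kc(1) c v by (metis DiffD1 antisym)
      then show "(crd \<Delta> (pos y) v - real (k v * d v)) *\<^sub>R v = 0" by simp
    qed
    finally show "pos y0 = (\<Sum>v\<in>V'. (crd \<Delta> (pos y) v - real (k v * d v)) *\<^sub>R v)" .
  qed
  then have y0d: "D y0 + dn y0 (sh Z x0) = (\<Sum>v\<in>V'. d v)"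
    unfolding Z_def by (rule arranged_dist[OF D V' y0])
  have "D y \<le> dn x0 (sh U x0) + dn (sh U x0) (sh U y0)"
    unfolding D_def yy0 using dn_triangle x0 y0 U by (simp add: sh_in)
  then have le1: "D y \<le> (\<Sum>v\<in>?V. k v * d v) + D y0"
    using length_mult_sum_le[OF D order.refl, of k] x0 y0 U unfolding D_def U_def[symmetric] by (simp add: dn_sh)
  define z where "z = sh (mult_sum ?V K) x0"
  have z: "z = sh (U + Z) (sh W x0)" "z \<in> VV"
    unfolding z_def using U Z W x0 by (simp_all add: UZW[symmetric] sh_add sh_in add_in_lat)
  have "dn y z \<le> dn y (sh (U + Z) x0) + dn (sh (U + Z) x0) z"
    using U Z W x0 y z by (intro dn_triangle) (simp_all add: sh_in add_in_lat)
  also have "dn (sh (U + Z) x0) z = dn x0 (sh W x0)"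
    unfolding z(1) using U Z W x0 by (intro dn_sh) (simp_all add: sh_in add_in_lat)
  also have "\<dots> \<le> (\<Sum>v\<in>?V. k2 v * d v)"
    unfolding W_def by (rule length_mult_sum_le[OF D order.refl])
  also have "dn y (sh (U + Z) x0) = dn y0 (sh Z x0)"
    unfolding yy0 using U Z x0 y0 dn_sh[of y0 "sh Z x0" U] by (simp add: sh_add sh_in)
  finally have le2: "dn y z \<le> dn y0 (sh Z x0) + (\<Sum>v\<in>?V. k2 v * d v)" by simp
  \<comment> \<open>The lower bound by the functional meets the upper bounds \<open>le1\<close> and
    \<open>le2\<close> obtained through the corners of the small box.\<close>
  have "(\<Sum>v\<in>?V. K v * d v) \<le> dn x0 z" unfolding z_def by (rule length_mult_sum_ge[OF D])
  also have "\<dots> \<le> D y + dn y z" unfolding D_def using dn_triangle x0 y z by blast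
  finally have "D y + dn y z = (\<Sum>v\<in>?V. K v * d v)" using le1 le2 y0d total by linarith
  \<comment> \<open>By symmetry and translation, the distance to the far corner becomes one measured
    from x0.\<close>
  moreover have "dn y z = D (sh (- mult_sum ?V K) y)"
  proof -
    have S: "mult_sum ?V K \<in> L" by (rule mult_sum_in_lat[OF D order.refl])
    have "dn y z = dn z y" using y z by (intro dn_sym)
    also have "\<dots> = dn (sh (- mult_sum ?V K) z) (sh (- mult_sum ?V K) y)"
      using y z S by (simp add: dn_sh uminus_in_lat)
    also have "sh (- mult_sum ?V K) z = x0"
      unfolding z_def using S x0 by (simp add: sh_add uminus_in_lat sh_0)
    finally show ?thesis by (simp add: D_def)
  qed
  ultimately show ?thesis by simp
qed

lemma mult_sum_upd:
  assumes "\<Delta> \<in> cells" "v \<in> vertices_of \<Delta>"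
  shows "mult_sum (vertices_of \<Delta>) (K(v := K v + m)) = mult_sum (vertices_of \<Delta>) K + real (m * d v) *\<^sub>R v"
    "(\<Sum>u\<in>vertices_of \<Delta>. (K(v := K v + m)) u * d u) = (\<Sum>u\<in>vertices_of \<Delta>. K u * d u) + m * d v"
  unfolding mult_sum_def using finite_cell[OF assms(1)] assms(2)
  by (simp_all add: sum.remove[of _ v] algebra_simps)

text \<open>\<open>box_dist\<close> for y in a box with multiplicities \<open>K\<close>, and for the
  shifted y in the box enlarged by \<open>m\<close> along \<open>v\<close>: the complementary vertex
  is the same, so the distances differ by the increase of the side sum.\<close>

lemma dist_shift_pos:
  assumes D: "\<Delta> \<in> cells" and v: "v \<in> vertices_of \<Delta>" and y: "y \<in> VV"
    and c: "\<And>u. u \<in> vertices_of \<Delta> \<Longrightarrow> 0 \<le> crd \<Delta> (pos y) u"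
  shows "D (sh (real (m * d v) *\<^sub>R v) y) = D y + m * d v"
proof -
  let ?V = "vertices_of \<Delta>"
  define K where "K u = nat \<lceil>crd \<Delta> (pos y) u / real (d u)\<rceil>" for u
  have K: "crd \<Delta> (pos y) u \<le> real (K u * d u)" if u: "u \<in> ?V" for u
  proof -
    have "crd \<Delta> (pos y) u / real (d u) \<le> real (K u)" unfolding K_def by linarith
    then show ?thesis using d_pos[OF D u] by (simp add: field_simps)
  qed
  let ?K = "K(v := K v + m)" and ?t = "real (m * d v) *\<^sub>R v"
  have t: "?t \<in> L" by (rule mult_in_lat[OF D v])
  have S: "mult_sum ?V K \<in> L" by (rule mult_sum_in_lat[OF D order.refl])
  have "D y + D (sh (- mult_sum ?V K) y) = (\<Sum>u\<in>?V. K u * d u)"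
    by (rule box_dist[OF D y]) (use c K in auto)
  moreover have "D (sh ?t y) + D (sh (- mult_sum ?V ?K) (sh ?t y)) = (\<Sum>u\<in>?V. ?K u * d u)"
  proof (rule box_dist[OF D])
    show "sh ?t y \<in> VV" using t y by (simp add: sh_in)
    show "0 \<le> crd \<Delta> (pos (sh ?t y)) u \<and> crd \<Delta> (pos (sh ?t y)) u \<le> real (?K u * d u)" if u: "u \<in> ?V" for u
      using c[OF u] K[OF u] t y by (auto simp: pos_sh crd_add D crd_mult[OF D v u] algebra_simps)
  qed
  moreover have "sh (- mult_sum ?V ?K) (sh ?t y) = sh (- mult_sum ?V K) y"
    using t S y unfolding mult_sum_upd[OF D v] by (simp add: sh_add uminus_in_lat add_in_lat del: minus_add_distrib) 
  ultimately show ?thesis unfolding mult_sum_upd[OF D v] by simp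
qed

text \<open>Now y is the complementary vertex of a point y' in a positive box. Enlarging the box
  along \<open>v\<close> keeps y' and moves the complementary vertex from y to the shifted
  y.\<close>

lemma dist_shift_neg:
  assumes D: "\<Delta> \<in> cells" and v: "v \<in> vertices_of \<Delta>" and y: "y \<in> VV"
    and c: "\<And>u. u \<in> vertices_of \<Delta> \<Longrightarrow> crd \<Delta> (pos y) u \<le> 0"
  shows "D (sh (- (real (m * d v) *\<^sub>R v)) y) = D y + m * d v"
proof -
  let ?V = "vertices_of \<Delta>"
  define K where "K u = nat \<lceil>- crd \<Delta> (pos y) u / real (d u)\<rceil>" for u
  have K: "- crd \<Delta> (pos y) u \<le> real (K u * d u)" if u: "u \<in> ?V" for u
  proof -
    have "- crd \<Delta> (pos y) u / real (d u) \<le> real (K u)" unfolding K_def by linarith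
    then show ?thesis using d_pos[OF D u] by (simp add: field_simps)
  qed
  let ?K = "K(v := K v + m)" and ?t = "real (m * d v) *\<^sub>R v"
  have t: "?t \<in> L" by (rule mult_in_lat[OF D v])
  have S: "mult_sum ?V K \<in> L" by (rule mult_sum_in_lat[OF D order.refl])
  define y' where "y' = sh (mult_sum ?V K) y"
  have y': "y' \<in> VV" using S y by (simp add: y'_def sh_in)
  have crd: "crd \<Delta> (pos y') u = crd \<Delta> (pos y) u + real (K u * d u)" if u: "u \<in> ?V" for u
    using S y by (simp add: y'_def pos_sh crd_add D crd_mult_sum[OF D u])
  have "D y' + D (sh (- mult_sum ?V K) y') = (\<Sum>u\<in>?V. K u * d u)"
    by (rule box_dist[OF D y']) (use c K in \<open>force simp: crd\<close>)
  moreover have "sh (- mult_sum ?V K) y' = y" using S y by (simp add: y'_def sh_add uminus_in_lat sh_0)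
  moreover have "D y' + D (sh (- mult_sum ?V ?K) y') = (\<Sum>u\<in>?V. ?K u * d u)"
  proof (rule box_dist[OF D y'])
    fix u assume u: "u \<in> ?V"
    have "K u \<le> ?K u" by simp
    then have "real (K u * d u) \<le> real (?K u * d u)" by (metis mult_le_mono1 of_nat_le_iff)
    then show "0 \<le> crd \<Delta> (pos y') u \<and> crd \<Delta> (pos y') u \<le> real (?K u * d u)"
      using c[OF u] K[OF u] unfolding crd[OF u] by linarith
  qed
  moreover have "sh (- mult_sum ?V ?K) y' = sh (- ?t) y"
    using t S y unfolding mult_sum_upd[OF D v] y'_def by (simp add: sh_add uminus_in_lat add_in_lat diff_in_lat)
  ultimately show ?thesis unfolding mult_sum_upd[OF D v] by simp
qed

lemma dist_shift:
  assumes D: "\<Delta> \<in> cells" and v: "v \<in> vertices_of \<Delta>" and y: "y \<in> VV"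
    and s: "s = 1 \<or> s = - 1"
    and c: "\<And>u. u \<in> vertices_of \<Delta> \<Longrightarrow> 0 \<le> s * crd \<Delta> (pos y) u"
  shows "D (sh ((s * real (m * d v)) *\<^sub>R v) y) = D y + m * d v"
  using s dist_shift_pos[OF D v y, of m] dist_shift_neg[OF D v y, of m] c by auto

end

section \<open>Counting over half-open cones\<close>

definition level_series :: "('x \<Rightarrow> nat) \<Rightarrow> 'x set \<Rightarrow> complex fps" where
  "level_series D Y = Abs_fps (\<lambda>i. of_nat (card {y \<in> Y. D y = i}))"

lemma level_series_Union:
  assumes "finite I" and disj: "disjoint_family_on Y I"
    and fin: "\<And>i. finite {y \<in> (\<Union>a\<in>I. Y a). D y = i}"
  shows "level_series D (\<Union>a\<in>I. Y a) = (\<Sum>a\<in>I. level_series D (Y a))"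
proof (rule fps_ext)
  fix i
  have "{y \<in> (\<Union>a\<in>I. Y a). D y = i} = (\<Union>a\<in>I. {y \<in> Y a. D y = i})" by auto
  moreover have "card (\<Union>a\<in>I. {y \<in> Y a. D y = i}) = (\<Sum>a\<in>I. card {y \<in> Y a. D y = i})"
  proof (rule card_UN_disjoint[OF assms(1)])
    show "\<forall>a\<in>I. finite {y \<in> Y a. D y = i}"
      using fin[of i] by (auto elim: finite_subset[rotated])
    show "\<forall>a\<in>I. \<forall>b\<in>I. a \<noteq> b \<longrightarrow> {y \<in> Y a. D y = i} \<inter> {y \<in> Y b. D y = i} = {}"
      using disj by (auto simp: disjoint_family_on_def)
  qed
  ultimately show "level_series D (\<Union>a\<in>I. Y a) $ i = (\<Sum>a\<in>I. level_series D (Y a)) $ i"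
    by (simp add: level_series_def fps_sum_nth)
qed

text \<open>The image of \<open>Y\<close> under \<tau> is a copy of \<open>Y\<close> with all levels
  raised by \<open>e\<close>, so t^e times the series counts this image.\<close>

lemma level_series_mult_one_minus:
  assumes fin: "\<And>i. finite {y \<in> Y. D y = i}"
    and inj: "inj_on \<tau> Y" and sub: "\<tau> ` Y \<subseteq> Y"
    and D: "\<And>y. y \<in> Y \<Longrightarrow> D (\<tau> y) = D y + e"
  shows "level_series D Y * (1 - fps_X ^ e) = level_series D (Y - \<tau> ` Y)"
proof (rule fps_ext)
  fix i
  have split: "card {y \<in> Y. D y = i} = card {y \<in> Y - \<tau> ` Y. D y = i} + card {y \<in> \<tau> ` Y. D y = i}"
    by (subst card_Un_disjoint[symmetric])
      (use sub in \<open>auto intro!: arg_cong[of _ _ card] finite_subset[OF _ fin[of i]]\<close>)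
  have "card {y \<in> \<tau> ` Y. D y = i} = (if i < e then 0 else card {y \<in> Y. D y = i - e})"
  proof (cases "i < e")
    case True
    then have e: "{y \<in> \<tau> ` Y. D y = i} = {}" using D by auto
    show ?thesis unfolding e using True by simp
  next
    case False
    then have "{y \<in> \<tau> ` Y. D y = i} = \<tau> ` {y \<in> Y. D y = i - e}" using D by auto
    then show ?thesis using False inj by (simp add: card_image inj_on_subset)
  qed
  then show "(level_series D Y * (1 - fps_X ^ e)) $ i = level_series D (Y - \<tau> ` Y) $ i"
    using split by (simp add: level_series_def right_diff_distrib fps_X_power_mult_right_nth)
qed

lemma level_series_poly:
  assumes "\<And>y. y \<in> Y \<Longrightarrow> D y \<le> E"
  shows "fps_of_poly (\<Sum>i\<le>E. monom (of_nat (card {y \<in> Y. D y = i})) i) = level_series D Y"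
proof (rule fps_ext)
  fix i
  have e: "{y \<in> Y. D y = i} = {}" if "\<not> i \<le> E" using assms that by auto
  have "of_nat (card {y \<in> Y. D y = i}) = (0 :: complex)" if "\<not> i \<le> E"
    unfolding e[OF that] by simp
  then show "fps_of_poly (\<Sum>i\<le>E. monom (of_nat (card {y \<in> Y. D y = i})) i) $ i = level_series D Y $ i"
    by (auto simp: level_series_def coeff_sum)
qed

lemma degree_one_minus_monom: "k > 0 \<Longrightarrow> degree (1 - monom 1 k :: complex poly) = k"
proof -
  assume k: "k > 0"
  have "degree (1 + - monom 1 k :: complex poly) = degree (- monom 1 k :: complex poly)"
    by (rule degree_add_eq_right) (use k in \<open>simp add: degree_monom_eq\<close>)
  then show ?thesis by (simp add: degree_monom_eq)
qed

section \<open>Sectors of the vertex set and their fundamental boxes\<close>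

context well_arranged
begin

text \<open>For s = 1 these are the vertices over the half-open cone of \<xi>, for s = -1 those over
  the negative of the half-open cone of -\<xi>. With the sign as a parameter both expansions share
  their proofs.\<close>

definition sector :: "real \<Rightarrow> 'a \<Rightarrow> 'a set \<Rightarrow> 'v set" where
  "sector s \<xi> \<Delta> = {y \<in> VV. s *\<^sub>R pos y \<in> half_open_cone (s *\<^sub>R \<xi>) \<Delta>}"

text \<open>Here \<open>m v * d v\<close> is the side of the box in direction \<open>v\<close>; only the sides in \<open>J\<close> are imposed, so
  that the directions can be cut off one at a time.\<close>

definition slab :: "real \<Rightarrow> 'a \<Rightarrow> ('a \<Rightarrow> nat) \<Rightarrow> 'a set \<Rightarrow> 'a set \<Rightarrow> 'v set" where
  "slab s \<xi> m \<Delta> J = {y \<in> sector s \<xi> \<Delta>. \<forall>v\<in>J. s * crd \<Delta> (pos y) v < real (m v * d v) \<or>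
     s * crd \<Delta> (pos y) v = real (m v * d v) \<and> s * crd \<Delta> \<xi> v < 0}"

lemma finite_level: "Y \<subseteq> VV \<Longrightarrow> finite {y \<in> Y. D y = i}"
  by (rule finite_subset[OF _ finite_ball[OF x0, of i]]) (auto simp: D_def)

lemma mem_sector: "\<Delta> \<in> cells \<Longrightarrow> y \<in> sector s \<xi> \<Delta> \<longleftrightarrow> y \<in> VV \<and>
    (\<forall>v\<in>vertices_of \<Delta>. s * crd \<Delta> (pos y) v > 0 \<or> s * crd \<Delta> (pos y) v = 0 \<and> s * crd \<Delta> \<xi> v > 0)"
  by (simp add: sector_def half_open_cone_def crd_scale)

lemma mem_slab: "\<Delta> \<in> cells \<Longrightarrow> y \<in> slab s \<xi> m \<Delta> J \<longleftrightarrow> y \<in> VV \<and>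
    (\<forall>v\<in>vertices_of \<Delta>. s * crd \<Delta> (pos y) v > 0 \<or> s * crd \<Delta> (pos y) v = 0 \<and> s * crd \<Delta> \<xi> v > 0) \<and>
    (\<forall>v\<in>J. s * crd \<Delta> (pos y) v < real (m v * d v) \<or>
      s * crd \<Delta> (pos y) v = real (m v * d v) \<and> s * crd \<Delta> \<xi> v < 0)"
  by (auto simp: slab_def mem_sector)

lemma lat_signed: "\<Delta> \<in> cells \<Longrightarrow> v \<in> vertices_of \<Delta> \<Longrightarrow> s = 1 \<or> s = - 1 \<Longrightarrow> (s * real (k * d v)) *\<^sub>R v \<in> L"
  using mult_in_lat[of \<Delta> v k] uminus_in_lat[of "real (k * d v) *\<^sub>R v"] by auto

text \<open>The shifted copy consists of the members whose signed coordinate along \<open>v\<close>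
  is beyond \<open>m v * d v\<close>, this value itself being included exactly if
  \<open>s * crd \<Delta> \<xi> v\<close> is positive. As that number is nonzero, the complement is
  given by the upper boundary rule of \<open>slab\<close>.\<close>

lemma slab_diff:
  fixes m :: "'a \<Rightarrow> nat"
  assumes D: "\<Delta> \<in> cells" and v: "v \<in> vertices_of \<Delta>" "v \<notin> J" and J: "J \<subseteq> vertices_of \<Delta>"
    and s: "s = 1 \<or> s = - 1" and gen: "crd \<Delta> \<xi> v \<noteq> 0"
  defines "\<tau> \<equiv> sh ((s * real (m v * d v)) *\<^sub>R v)"
  shows "\<tau> ` slab s \<xi> m \<Delta> J \<subseteq> slab s \<xi> m \<Delta> J"
    and "slab s \<xi> m \<Delta> J - \<tau> ` slab s \<xi> m \<Delta> J = slab s \<xi> m \<Delta> (insert v J)"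
proof -
  let ?t = "(s * real (m v * d v)) *\<^sub>R v"
  have t: "?t \<in> L" using lat_signed[OF D v(1) s] .
  have ss: "s * (s * r) = r" for r using s by auto
  have crd: "s * crd \<Delta> (pos (\<tau> y)) u = s * crd \<Delta> (pos y) u + (if u = v then real (m v * d v) else 0)"
    if "y \<in> VV" "u \<in> vertices_of \<Delta>" for y u
    using that t D by (simp add: \<tau>_def pos_sh crd_add crd_mult[OF D v(1)] distrib_left ss del: of_nat_mult)
  have in_VV: "\<tau> y \<in> VV" if "y \<in> VV" for y using that t by (simp add: \<tau>_def sh_in)
  show sub: "\<tau> ` slab s \<xi> m \<Delta> J \<subseteq> slab s \<xi> m \<Delta> J"
  proof
    fix z assume "z \<in> \<tau> ` slab s \<xi> m \<Delta> J"
    then obtain y where y: "y \<in> slab s \<xi> m \<Delta> J" "z = \<tau> y" by blast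
    then have yV: "y \<in> VV" by (simp add: mem_slab D)
    have zc: "s * crd \<Delta> (pos z) u = s * crd \<Delta> (pos y) u + (if u = v then real (m v * d v) else 0)"
      if "u \<in> vertices_of \<Delta>" for u using crd[OF yV that] unfolding y(2) .
    have r0: "0 \<le> (if u = v then real (m v * d v) else 0)" for u by simp
    show "z \<in> slab s \<xi> m \<Delta> J"
      unfolding mem_slab[OF D]
    proof (intro conjI ballI)
      show "z \<in> VV" using y in_VV yV by simp
      fix u assume u: "u \<in> vertices_of \<Delta>"
      have "s * crd \<Delta> (pos y) u > 0 \<or> s * crd \<Delta> (pos y) u = 0 \<and> s * crd \<Delta> \<xi> u > 0"
        using y(1) u unfolding mem_slab[OF D] by blast
      then show "s * crd \<Delta> (pos z) u > 0 \<or> s * crd \<Delta> (pos z) u = 0 \<and> s * crd \<Delta> \<xi> u > 0"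
        unfolding zc[OF u] using r0[of u] by linarith
    next
      fix u assume u: "u \<in> J"
      then have "u \<in> vertices_of \<Delta>" "u \<noteq> v" using J v by auto
      then have "s * crd \<Delta> (pos z) u = s * crd \<Delta> (pos y) u"
        using zc[of u] by (simp only: if_False add_0_right diff_0_right)
      moreover have "s * crd \<Delta> (pos y) u < real (m u * d u) \<or> s * crd \<Delta> (pos y) u = real (m u * d u) \<and> s * crd \<Delta> \<xi> u < 0"
        using y(1) u unfolding mem_slab[OF D] by blast
      ultimately show "s * crd \<Delta> (pos z) u < real (m u * d u) \<or> s * crd \<Delta> (pos z) u = real (m u * d u) \<and> s * crd \<Delta> \<xi> u < 0"
        by (simp only:)
    qed
  qed
  show "slab s \<xi> m \<Delta> J - \<tau> ` slab s \<xi> m \<Delta> J = slab s \<xi> m \<Delta> (insert v J)"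
  proof (intro set_eqI iffI)
    fix z assume z: "z \<in> slab s \<xi> m \<Delta> J - \<tau> ` slab s \<xi> m \<Delta> J"
    then have zV: "z \<in> VV" by (simp add: mem_slab D)
    have "s * crd \<Delta> (pos z) v < real (m v * d v) \<or> s * crd \<Delta> (pos z) v = real (m v * d v) \<and> s * crd \<Delta> \<xi> v < 0"
    proof (rule ccontr)
      assume neg: "\<not> ?thesis"
      have "s * crd \<Delta> \<xi> v \<noteq> 0" using gen s by auto
      then have large: "s * crd \<Delta> (pos z) v > real (m v * d v) \<or> s * crd \<Delta> (pos z) v = real (m v * d v) \<and> s * crd \<Delta> \<xi> v > 0"
        using neg by linarith
      define y where "y = sh (- ?t) z"
      have yV: "y \<in> VV" and zy: "z = \<tau> y"
        using zV t by (simp_all add: y_def \<tau>_def sh_in uminus_in_lat sh_add sh_0)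
      have yc: "s * crd \<Delta> (pos y) u = s * crd \<Delta> (pos z) u - (if u = v then real (m v * d v) else 0)"
        if "u \<in> vertices_of \<Delta>" for u using crd[OF yV that] unfolding zy by linarith
      have "y \<in> slab s \<xi> m \<Delta> J"
        unfolding mem_slab[OF D]
      proof (intro conjI ballI)
        show "y \<in> VV" by (rule yV)
        fix u assume u: "u \<in> vertices_of \<Delta>"
        have "s * crd \<Delta> (pos z) u > 0 \<or> s * crd \<Delta> (pos z) u = 0 \<and> s * crd \<Delta> \<xi> u > 0"
          using z u unfolding Diff_iff mem_slab[OF D] by blast
        moreover have "s * crd \<Delta> (pos y) v = s * crd \<Delta> (pos z) v - real (m v * d v)"
          using yc[OF v(1)] by (simp only: refl if_True)
        moreover have "s * crd \<Delta> (pos y) u = s * crd \<Delta> (pos z) u" if "u \<noteq> v"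
          using yc[OF u] that by (simp only: if_False diff_0_right)
        ultimately show "s * crd \<Delta> (pos y) u > 0 \<or> s * crd \<Delta> (pos y) u = 0 \<and> s * crd \<Delta> \<xi> u > 0"
          using large by (cases "u = v") (hypsubst, linarith, linarith)
      next
        fix u assume u: "u \<in> J"
        then have "u \<in> vertices_of \<Delta>" "u \<noteq> v" using J v by auto
        then have "s * crd \<Delta> (pos y) u = s * crd \<Delta> (pos z) u"
          using yc[of u] by (simp only: if_False add_0_right diff_0_right)
        moreover have "s * crd \<Delta> (pos z) u < real (m u * d u) \<or> s * crd \<Delta> (pos z) u = real (m u * d u) \<and> s * crd \<Delta> \<xi> u < 0"
          using z u unfolding Diff_iff mem_slab[OF D] by blast
        ultimately show "s * crd \<Delta> (pos y) u < real (m u * d u) \<or> s * crd \<Delta> (pos y) u = real (m u * d u) \<and> s * crd \<Delta> \<xi> u < 0"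
          by (simp only:)
      qed
      then show False using z zy by blast
    qed
    then show "z \<in> slab s \<xi> m \<Delta> (insert v J)" using z by (auto simp: slab_def)
  next
    fix z assume z: "z \<in> slab s \<xi> m \<Delta> (insert v J)"
    have "z \<noteq> \<tau> y" if y: "y \<in> slab s \<xi> m \<Delta> J" for y
    proof
      assume zy: "z = \<tau> y"
      have yV: "y \<in> VV" using y by (simp add: mem_slab D)
      have "s * crd \<Delta> (pos y) v > 0 \<or> s * crd \<Delta> (pos y) v = 0 \<and> s * crd \<Delta> \<xi> v > 0"
        using y v unfolding mem_slab[OF D] by blast
      moreover have "s * crd \<Delta> (pos z) v < real (m v * d v) \<or> s * crd \<Delta> (pos z) v = real (m v * d v) \<and> s * crd \<Delta> \<xi> v < 0"
        using z unfolding slab_def by blast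
      moreover have "s * crd \<Delta> (pos z) v = s * crd \<Delta> (pos y) v + real (m v * d v)"
        using crd[OF yV v(1)] unfolding zy by (simp only: refl if_True)
      ultimately show False by linarith
    qed
    then show "z \<in> slab s \<xi> m \<Delta> J - \<tau> ` slab s \<xi> m \<Delta> J" using z by (auto simp: slab_def)
  qed
qed

text \<open>Each direction cut off contributes one factor, because by \<open>dist_shift\<close> the
  shift along \<open>v\<close> raises the distance by \<open>m v * d v\<close> on the whole
  slab.\<close>

lemma sector_series:
  assumes D: "\<Delta> \<in> cells" and s: "s = 1 \<or> s = - 1"
    and gen: "\<And>v. v \<in> vertices_of \<Delta> \<Longrightarrow> crd \<Delta> \<xi> v \<noteq> 0"
  shows "level_series D (sector s \<xi> \<Delta>) * (\<Prod>v\<in>vertices_of \<Delta>. 1 - fps_X ^ (m v * d v))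
    = level_series D (slab s \<xi> m \<Delta> (vertices_of \<Delta>))"
proof -
  have "level_series D (sector s \<xi> \<Delta>) * (\<Prod>v\<in>J. 1 - fps_X ^ (m v * d v)) = level_series D (slab s \<xi> m \<Delta> J)"
    if "finite J" "J \<subseteq> vertices_of \<Delta>" for J
    using that
  proof (induction J)
    case empty
    then show ?case by (simp add: slab_def)
  next
    case (insert v J)
    then have v: "v \<in> vertices_of \<Delta>" and J: "J \<subseteq> vertices_of \<Delta>" by auto
    let ?\<tau> = "sh ((s * real (m v * d v)) *\<^sub>R v)"
    have sV: "slab s \<xi> m \<Delta> J \<subseteq> VV" by (auto simp: mem_slab D)
    have "level_series D (sector s \<xi> \<Delta>) * (\<Prod>v\<in>insert v J. 1 - fps_X ^ (m v * d v))
        = level_series D (sector s \<xi> \<Delta>) * (\<Prod>v\<in>J. 1 - fps_X ^ (m v * d v)) * (1 - fps_X ^ (m v * d v))"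
      using insert.hyps by (simp add: ac_simps)
    also have "\<dots> = level_series D (slab s \<xi> m \<Delta> J) * (1 - fps_X ^ (m v * d v))"
      using insert.IH[OF J] by simp
    also have "\<dots> = level_series D (slab s \<xi> m \<Delta> J - ?\<tau> ` slab s \<xi> m \<Delta> J)"
    proof (rule level_series_mult_one_minus)
      show "finite {y \<in> slab s \<xi> m \<Delta> J. D y = i}" for i by (rule finite_level[OF sV])
      show "inj_on ?\<tau> (slab s \<xi> m \<Delta> J)"
        by (rule inj_onI) (use sh_inj_vertex lat_signed[OF D v s] sV in blast)
      show "?\<tau> ` slab s \<xi> m \<Delta> J \<subseteq> slab s \<xi> m \<Delta> J"
        by (rule slab_diff(1)[OF D v insert.hyps(2) J s gen[OF v]])
      show "D (?\<tau> y) = D y + m v * d v" if y: "y \<in> slab s \<xi> m \<Delta> J" for y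
      proof (rule dist_shift[OF D v _ s])
        show "y \<in> VV" using y sV by blast
        fix u assume u: "u \<in> vertices_of \<Delta>"
        have "s * crd \<Delta> (pos y) u > 0 \<or> s * crd \<Delta> (pos y) u = 0 \<and> s * crd \<Delta> \<xi> u > 0"
          using y u unfolding mem_slab[OF D] by blast
        then show "0 \<le> s * crd \<Delta> (pos y) u" by linarith
      qed
    qed
    also have "slab s \<xi> m \<Delta> J - ?\<tau> ` slab s \<xi> m \<Delta> J = slab s \<xi> m \<Delta> (insert v J)"
      by (rule slab_diff(2)[OF D v insert.hyps(2) J s gen[OF v]])
    finally show ?case .
  qed
  then show ?thesis using finite_cell[OF D] by blast
qed

abbreviation "half_box s \<xi> m \<Delta> \<equiv> slab s \<xi> m \<Delta> (vertices_of \<Delta>)"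

text \<open>Translation by -S takes a coordinate c to c - m v * d v, whose negative measures the
  same side from its other end. A box keeps the lower end of a side if \<xi> is positive there and
  the upper end if it is negative; exchanging the ends and the sign of \<xi> preserves this
  rule.\<close>

lemma box_reflect:
  fixes m :: "'a \<Rightarrow> nat"
  assumes D: "\<Delta> \<in> cells"
  defines "S \<equiv> mult_sum (vertices_of \<Delta>) m"
  shows "bij_betw (sh (- S)) (half_box 1 \<xi> m \<Delta>) (half_box (- 1) \<xi> m \<Delta>)"
    and "y \<in> half_box 1 \<xi> m \<Delta> \<Longrightarrow> D y + D (sh (- S) y) = (\<Sum>v\<in>vertices_of \<Delta>. m v * d v)"
proof -
  have S: "S \<in> L" unfolding S_def by (rule mult_sum_in_lat[OF D order.refl])
  have crd: "crd \<Delta> (pos (sh (- S) y)) v = crd \<Delta> (pos y) v - real (m v * d v)"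
    "crd \<Delta> (pos (sh S y)) v = crd \<Delta> (pos y) v + real (m v * d v)"
    if "y \<in> VV" "v \<in> vertices_of \<Delta>" for y v
  proof -
    have c: "crd \<Delta> S v = real (m v * d v)" unfolding S_def by (rule crd_mult_sum[OF D that(2)])
    show "crd \<Delta> (pos (sh (- S) y)) v = crd \<Delta> (pos y) v - real (m v * d v)"
      "crd \<Delta> (pos (sh S y)) v = crd \<Delta> (pos y) v + real (m v * d v)"
      using that S by (simp_all only: pos_sh uminus_in_lat crd_add[OF D] crd_minus[OF D] c)
  qed
  have VV: "half_box s \<xi> m \<Delta> \<subseteq> VV" for s by (auto simp: mem_slab D)
  have inv: "sh S (sh (- S) y) = y" "sh (- S) (sh S y) = y" if "y \<in> VV" for y
    using that S by (simp_all add: sh_add uminus_in_lat sh_0)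
  have fwd: "sh (- S) y \<in> half_box (- 1) \<xi> m \<Delta>" if y: "y \<in> half_box 1 \<xi> m \<Delta>" for y
    unfolding mem_slab[OF D]
  proof (intro conjI ballI)
    have yV: "y \<in> VV" using y VV by blast
    then show "sh (- S) y \<in> VV" using S by (simp add: sh_in uminus_in_lat)
    fix v assume v: "v \<in> vertices_of \<Delta>"
    have "crd \<Delta> (pos y) v > 0 \<or> crd \<Delta> (pos y) v = 0 \<and> crd \<Delta> \<xi> v > 0"
      "crd \<Delta> (pos y) v < real (m v * d v) \<or> crd \<Delta> (pos y) v = real (m v * d v) \<and> crd \<Delta> \<xi> v < 0"
      using y v by (simp_all add: mem_slab D)
    note h = this
    show "- 1 * crd \<Delta> (pos (sh (- S) y)) v > 0 \<or> - 1 * crd \<Delta> (pos (sh (- S) y)) v = 0 \<and> - 1 * crd \<Delta> \<xi> v > 0"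
      using h unfolding crd(1)[OF yV v] by (smt (verit))
    show "- 1 * crd \<Delta> (pos (sh (- S) y)) v < real (m v * d v) \<or>
        - 1 * crd \<Delta> (pos (sh (- S) y)) v = real (m v * d v) \<and> - 1 * crd \<Delta> \<xi> v < 0"
      using h unfolding crd(1)[OF yV v] by (smt (verit))
  qed
  have bwd: "sh S y \<in> half_box 1 \<xi> m \<Delta>" if y: "y \<in> half_box (- 1) \<xi> m \<Delta>" for y
    unfolding mem_slab[OF D]
  proof (intro conjI ballI)
    have yV: "y \<in> VV" using y VV by blast
    then show "sh S y \<in> VV" using S by (simp add: sh_in)
    fix v assume v: "v \<in> vertices_of \<Delta>"
    have "- crd \<Delta> (pos y) v > 0 \<or> - crd \<Delta> (pos y) v = 0 \<and> - crd \<Delta> \<xi> v > 0"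
      "- crd \<Delta> (pos y) v < real (m v * d v) \<or> - crd \<Delta> (pos y) v = real (m v * d v) \<and> - crd \<Delta> \<xi> v < 0"
      using y v by (simp_all add: mem_slab D)
    note h = this
    show "1 * crd \<Delta> (pos (sh S y)) v > 0 \<or> 1 * crd \<Delta> (pos (sh S y)) v = 0 \<and> 1 * crd \<Delta> \<xi> v > 0"
      using h unfolding crd(2)[OF yV v] by (smt (verit))
    show "1 * crd \<Delta> (pos (sh S y)) v < real (m v * d v) \<or>
        1 * crd \<Delta> (pos (sh S y)) v = real (m v * d v) \<and> 1 * crd \<Delta> \<xi> v < 0"
      using h unfolding crd(2)[OF yV v] by (smt (verit))
  qed
  show "bij_betw (sh (- S)) (half_box 1 \<xi> m \<Delta>) (half_box (- 1) \<xi> m \<Delta>)"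
    by (rule bij_betw_byWitness[of _ "sh S"]) (use inv VV fwd bwd in auto)
  show "D y + D (sh (- S) y) = (\<Sum>v\<in>vertices_of \<Delta>. m v * d v)" if y: "y \<in> half_box 1 \<xi> m \<Delta>"
    unfolding S_def
  proof (rule box_dist[OF D])
    show "y \<in> VV" using y VV by blast
    fix v assume v: "v \<in> vertices_of \<Delta>"
    have "1 * crd \<Delta> (pos y) v > 0 \<or> 1 * crd \<Delta> (pos y) v = 0 \<and> 1 * crd \<Delta> \<xi> v > 0"
      "1 * crd \<Delta> (pos y) v < real (m v * d v) \<or> 1 * crd \<Delta> (pos y) v = real (m v * d v) \<and> 1 * crd \<Delta> \<xi> v < 0"
      using y v unfolding mem_slab[OF D] by blast+
    then show "0 \<le> crd \<Delta> (pos y) v \<and> crd \<Delta> (pos y) v \<le> real (m v * d v)"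
      by (smt (verit) mult_1)
  qed
qed

definition box_poly :: "real \<Rightarrow> 'a \<Rightarrow> ('a \<Rightarrow> nat) \<Rightarrow> 'a set \<Rightarrow> complex poly" where
  "box_poly s \<xi> m \<Delta> = (\<Sum>i\<le>(\<Sum>v\<in>vertices_of \<Delta>. m v * d v).
     monom (of_nat (card {y \<in> half_box s \<xi> m \<Delta>. D y = i})) i)"

lemma degree_box_poly: "degree (box_poly s \<xi> m \<Delta>) \<le> (\<Sum>v\<in>vertices_of \<Delta>. m v * d v)"
  unfolding box_poly_def by (intro degree_sum_le) (auto intro: order.trans[OF degree_monom_le])

text \<open>The truncation in \<open>box_poly\<close> loses nothing: by \<open>box_reflect\<close>
  the distances of a vertex and of its partner add up to the side sum, so neither exceeds
  it.\<close>

lemma fps_of_box_poly: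
  assumes D: "\<Delta> \<in> cells" and s: "s = 1 \<or> s = - 1"
  shows "fps_of_poly (box_poly s \<xi> m \<Delta>) = level_series D (half_box s \<xi> m \<Delta>)"
  unfolding box_poly_def
proof (rule level_series_poly)
  fix y assume y: "y \<in> half_box s \<xi> m \<Delta>"
  consider "s = 1" | "s = - 1" using s by blast
  then show "D y \<le> (\<Sum>v\<in>vertices_of \<Delta>. m v * d v)"
  proof cases
    case 1
    then show ?thesis using box_reflect(2)[OF D, of y \<xi> m] y by simp
  next
    case 2
    then obtain y' where "y' \<in> half_box 1 \<xi> m \<Delta>" "y = sh (- mult_sum (vertices_of \<Delta>) m) y'"
      using box_reflect(1)[OF D, of m \<xi>] y unfolding bij_betw_def by blast
    then show ?thesis using box_reflect(2)[OF D, of y' \<xi> m] by simp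
  qed
qed

lemma box_poly_reflect:
  assumes D: "\<Delta> \<in> cells" and i: "i \<le> (\<Sum>v\<in>vertices_of \<Delta>. m v * d v)"
  shows "coeff (box_poly (- 1) \<xi> m \<Delta>) i = coeff (box_poly 1 \<xi> m \<Delta>) ((\<Sum>v\<in>vertices_of \<Delta>. m v * d v) - i)"
proof -
  let ?E = "\<Sum>v\<in>vertices_of \<Delta>. m v * d v" and ?f = "sh (- mult_sum (vertices_of \<Delta>) m)"
  note bij = box_reflect(1)[OF D, of m \<xi>] and refl = box_reflect(2)[OF D, of _ \<xi> m]
  have img: "?f ` {y \<in> half_box 1 \<xi> m \<Delta>. D y = ?E - i} = {y \<in> half_box (- 1) \<xi> m \<Delta>. D y = i}"
  proof (intro set_eqI iffI)
    fix z assume "z \<in> ?f ` {y \<in> half_box 1 \<xi> m \<Delta>. D y = ?E - i}"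
    then obtain y where y: "y \<in> half_box 1 \<xi> m \<Delta>" "D y = ?E - i" "z = ?f y" by blast
    then have "z \<in> half_box (- 1) \<xi> m \<Delta>" using bij unfolding bij_betw_def by blast
    moreover have "D z = i" using refl[OF y(1)] y i by simp
    ultimately show "z \<in> {y \<in> half_box (- 1) \<xi> m \<Delta>. D y = i}" by simp
  next
    fix z assume z: "z \<in> {y \<in> half_box (- 1) \<xi> m \<Delta>. D y = i}"
    then obtain y where y: "y \<in> half_box 1 \<xi> m \<Delta>" "z = ?f y" using bij unfolding bij_betw_def by blast
    moreover have "D y = ?E - i" using refl[OF y(1)] y z by simp
    ultimately show "z \<in> ?f ` {y \<in> half_box 1 \<xi> m \<Delta>. D y = ?E - i}" by blast
  qed
  have "inj_on ?f {y \<in> half_box 1 \<xi> m \<Delta>. D y = ?E - i}"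
    by (rule inj_on_subset[OF bij_betw_imp_inj_on[OF bij]]) blast
  then have "card {y \<in> half_box (- 1) \<xi> m \<Delta>. D y = i} = card {y \<in> half_box 1 \<xi> m \<Delta>. D y = ?E - i}"
    unfolding img[symmetric] by (rule card_image)
  then show ?thesis using i by (simp add: box_poly_def coeff_sum)
qed

text \<open>Both signs expand the same series, since s * \<xi> is generic as well and scaling by s
  only changes which point is located in the partition.\<close>

lemma growth_series_sectors:
  assumes gen: "\<And>\<Delta> v. \<Delta> \<in> cells \<Longrightarrow> v \<in> vertices_of \<Delta> \<Longrightarrow> crd \<Delta> \<xi> v \<noteq> 0"
    and s: "s = 1 \<or> s = - 1"
  shows "gen_series (sphere_count \<Gamma> x0) = (\<Sum>\<Delta>\<in>cells. level_series D (sector s \<xi> \<Delta>))"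
proof -
  have ex1: "\<exists>!\<Delta>. \<Delta> \<in> cells \<and> s *\<^sub>R pos y \<in> half_open_cone (s *\<^sub>R \<xi>) \<Delta>" for y
    by (rule half_open_cone_partition) (use gen s in \<open>auto simp: crd_scale\<close>)
  have un: "VV = (\<Union>\<Delta>\<in>cells. sector s \<xi> \<Delta>)"
  proof (intro equalityI subsetI)
    fix y assume y: "y \<in> VV"
    obtain \<Delta> where "\<Delta> \<in> cells" "s *\<^sub>R pos y \<in> half_open_cone (s *\<^sub>R \<xi>) \<Delta>"
      using ex1[of y] by blast
    then show "y \<in> (\<Union>\<Delta>\<in>cells. sector s \<xi> \<Delta>)" using y by (auto simp: sector_def)
  qed (auto simp: sector_def)
  have "gen_series (sphere_count \<Gamma> x0) = level_series D VV"
    unfolding gen_series_def level_series_def sphere_count_def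
    by (intro arg_cong[of _ _ Abs_fps] ext arg_cong[of _ _ of_nat] arg_cong[of _ _ card])
      (use x0 in \<open>auto simp: gdist_eq_dn D_def\<close>)
  also have "\<dots> = (\<Sum>\<Delta>\<in>cells. level_series D (sector s \<xi> \<Delta>))"
    unfolding un
  proof (rule level_series_Union[OF finite_cells])
    show "disjoint_family_on (sector s \<xi>) cells"
      unfolding disjoint_family_on_def
    proof (intro ballI impI equals0I)
      fix \<Delta> \<Delta>' y assume "\<Delta> \<in> cells" "\<Delta>' \<in> cells" "\<Delta> \<noteq> \<Delta>'" "y \<in> sector s \<xi> \<Delta> \<inter> sector s \<xi> \<Delta>'"
      then show False using ex1[of y] unfolding sector_def by blast
    qed
    show "finite {y \<in> \<Union> (sector s \<xi> ` cells). D y = i}" for i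
      by (rule finite_level) (auto simp: sector_def)
  qed
  finally show ?thesis .
qed

end

section \<open>The least common denominator and the palindromic numerator\<close>

context well_arranged
begin

lemma denominator_eq:
  "growth_denominator \<Gamma> d T = Lcm ((\<lambda>\<Delta>. \<Prod>v\<in>vertices_of \<Delta>. 1 - monom 1 (d v)) ` cells)"
  unfolding growth_denominator_def cells_def by (rule arg_cong[of _ _ Lcm]) auto

text \<open>Boxes of multiplicity 1 give each sector the denominator \<open>den \<Delta>\<close>,
  whose degree is the side sum and hence bounds the degree of the numerator. Extending the fractions
  by \<open>R \<Delta>\<close> preserves this inequality.\<close>

lemma growth_series_rational:
  "\<exists>Q1 Q2 :: complex poly.
     Q2 = growth_denominator \<Gamma> d T \<and> Q2 \<noteq> 0 \<and>
     gen_series (sphere_count \<Gamma> x0) * fps_of_poly Q2 = fps_of_poly Q1 \<and>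
     degree Q1 \<le> degree Q2"
proof -
  obtain \<xi> where gen: "\<And>\<Delta> v. \<Delta> \<in> cells \<Longrightarrow> v \<in> vertices_of \<Delta> \<Longrightarrow> crd \<Delta> \<xi> v \<noteq> 0"
    using generic_vector by blast
  define den :: "'a set \<Rightarrow> complex poly" where
    "den \<Delta> = (\<Prod>v\<in>vertices_of \<Delta>. 1 - monom 1 (d v))" for \<Delta>
  let ?Q = "growth_denominator \<Gamma> d T"
  have Q: "?Q = Lcm (den ` cells)" unfolding denominator_eq den_def ..
  have den0: "den \<Delta> \<noteq> 0" if "\<Delta> \<in> cells" for \<Delta>
    unfolding den_def using finite_cell[OF that] d_pos[OF that] one_minus_monom_nonzero[where 'a = complex]
    by (simp add: prod_zero_iff Suc_le_eq)
  have Q0: "?Q \<noteq> 0"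
  proof -
    have "finite (den ` cells)" using finite_cells by simp
    then show ?thesis unfolding Q using den0 by (subst Lcm_0_iff) auto
  qed
  define R where "R \<Delta> = ?Q div den \<Delta>" for \<Delta>
  have R: "?Q = R \<Delta> * den \<Delta>" if "\<Delta> \<in> cells" for \<Delta>
  proof -
    have "den \<Delta> dvd ?Q" unfolding Q using that by (intro dvd_Lcm) simp
    then show ?thesis by (simp add: R_def)
  qed
  have fden: "fps_of_poly (den \<Delta>) = (\<Prod>v\<in>vertices_of \<Delta>. 1 - fps_X ^ (1 * d v))" for \<Delta>
    by (simp add: den_def fps_of_poly_prod fps_of_poly_diff fps_of_poly_monom)
  define Q1 where "Q1 = (\<Sum>\<Delta>\<in>cells. box_poly 1 \<xi> (\<lambda>_. 1) \<Delta> * R \<Delta>)"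
  have "gen_series (sphere_count \<Gamma> x0) * fps_of_poly ?Q
      = (\<Sum>\<Delta>\<in>cells. level_series D (sector 1 \<xi> \<Delta>) * fps_of_poly ?Q)"
    using growth_series_sectors[OF gen, of 1] by (simp add: sum_distrib_right)
  also have "\<dots> = (\<Sum>\<Delta>\<in>cells. fps_of_poly (box_poly 1 \<xi> (\<lambda>_. 1) \<Delta> * R \<Delta>))"
  proof (rule sum.cong)
    fix \<Delta> assume D: "\<Delta> \<in> cells"
    have "level_series D (sector 1 \<xi> \<Delta>) * fps_of_poly (den \<Delta>) = fps_of_poly (box_poly 1 \<xi> (\<lambda>_. 1) \<Delta>)"
      unfolding fden using sector_series[OF D, of 1 \<xi> "\<lambda>_. 1"] gen[OF D] fps_of_box_poly[OF D, of 1 \<xi> "\<lambda>_. 1"]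
      by simp
    moreover have "level_series D (sector 1 \<xi> \<Delta>) * fps_of_poly ?Q
        = level_series D (sector 1 \<xi> \<Delta>) * fps_of_poly (den \<Delta>) * fps_of_poly (R \<Delta>)"
      by (subst R[OF D]) (simp add: fps_of_poly_mult ac_simps)
    ultimately show "level_series D (sector 1 \<xi> \<Delta>) * fps_of_poly ?Q = fps_of_poly (box_poly 1 \<xi> (\<lambda>_. 1) \<Delta> * R \<Delta>)"
      by (simp add: fps_of_poly_mult)
  qed simp
  also have "\<dots> = fps_of_poly Q1" by (simp add: Q1_def fps_of_poly_sum)
  finally have eq: "gen_series (sphere_count \<Gamma> x0) * fps_of_poly ?Q = fps_of_poly Q1" .
  have "degree Q1 \<le> degree ?Q"
    unfolding Q1_def
  proof (rule degree_sum_le[OF finite_cells])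
    fix \<Delta> assume D: "\<Delta> \<in> cells"
    have "degree (den \<Delta>) = (\<Sum>v\<in>vertices_of \<Delta>. degree (1 - monom 1 (d v) :: complex poly))"
      unfolding den_def
      by (rule degree_prod_eq_sum_degree) (use d_pos[OF D] one_minus_monom_nonzero[where 'a = complex] in \<open>simp add: Suc_le_eq\<close>)
    also have "\<dots> = (\<Sum>v\<in>vertices_of \<Delta>. 1 * d v)"
      by (rule sum.cong) (use d_pos[OF D] in \<open>simp_all add: degree_one_minus_monom\<close>)
    finally have dd: "degree (box_poly 1 \<xi> (\<lambda>_. 1) \<Delta>) \<le> degree (den \<Delta>)"
      using degree_box_poly[of 1 \<xi> "\<lambda>_. 1" \<Delta>] by simp
    have "R \<Delta> \<noteq> 0" using R[OF D] Q0 by auto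
    then have "degree ?Q = degree (R \<Delta>) + degree (den \<Delta>)"
      using R[OF D] den0[OF D] by (metis degree_mult_eq)
    then show "degree (box_poly 1 \<xi> (\<lambda>_. 1) \<Delta> * R \<Delta>) \<le> degree ?Q"
      using degree_mult_le[of "box_poly 1 \<xi> (\<lambda>_. 1) \<Delta>" "R \<Delta>"] dd by linarith
  qed
  then show ?thesis using eq Q0 by blast
qed

text \<open>Stretching all boxes to a common side \<open>N\<close> gives one denominator. Expanding the growth
  series over the sectors of \<open>\<xi>\<close> and over the opposite ones yields the same numerator, while
  reflecting the boxes reverses its coefficients.\<close>

lemma palindromic_numerator:
  "\<exists>N (S :: complex poly). N \<ge> 1 \<and> degree S \<le> n * N \<and>
    (\<forall>k\<le>n * N. coeff S (n * N - k) = coeff S k) \<and>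
    gen_series (sphere_count \<Gamma> x0) * fps_of_poly ((1 - monom 1 N) ^ n) = fps_of_poly S"
proof -
  obtain \<xi> where gen: "\<And>\<Delta> v. \<Delta> \<in> cells \<Longrightarrow> v \<in> vertices_of \<Delta> \<Longrightarrow> crd \<Delta> \<xi> v \<noteq> 0"
    using generic_vector by blast
  define W where "W = (\<Union>\<Delta>\<in>cells. vertices_of \<Delta>)"
  have finW: "finite W" using finite_cells finite_cell by (simp add: W_def)
  \<comment> \<open>A common multiple of all \<open>d v\<close>, so that each box can be stretched
    to side \<open>N\<close> in all its directions and has side sum n * N.\<close>
  define N where "N = (\<Prod>v\<in>W. d v)"
  have N: "N \<ge> 1" unfolding N_def using d_pos by (auto simp: W_def Suc_le_eq intro!: prod_pos)
  define m where "m v = N div d v" for v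
  have md: "m v * d v = N" if "\<Delta> \<in> cells" "v \<in> vertices_of \<Delta>" for \<Delta> v
  proof -
    have "d v dvd N" unfolding N_def using that finW by (intro dvd_prodI) (auto simp: W_def)
    then show ?thesis by (simp add: m_def)
  qed
  have E: "(\<Sum>v\<in>vertices_of \<Delta>. m v * d v) = n * N" if D: "\<Delta> \<in> cells" for \<Delta>
  proof -
    have "(\<Sum>v\<in>vertices_of \<Delta>. m v * d v) = (\<Sum>v\<in>vertices_of \<Delta>. N)"
      by (rule sum.cong) (use md[OF D] in auto)
    then show ?thesis using card_cell[OF D] DIM_eq by simp
  qed
  define S where "S s = (\<Sum>\<Delta>\<in>cells. box_poly s \<xi> m \<Delta>)" for s
  have S: "gen_series (sphere_count \<Gamma> x0) * fps_of_poly ((1 - monom 1 N) ^ n) = fps_of_poly (S s)"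
    if s: "s = 1 \<or> s = - 1" for s
  proof -
    have "gen_series (sphere_count \<Gamma> x0) * fps_of_poly ((1 - monom 1 N) ^ n)
        = (\<Sum>\<Delta>\<in>cells. level_series D (sector s \<xi> \<Delta>) * (1 - fps_X ^ N) ^ n)"
      using growth_series_sectors[OF gen s]
      by (simp add: sum_distrib_right fps_of_poly_power fps_of_poly_diff fps_of_poly_monom)
    also have "\<dots> = (\<Sum>\<Delta>\<in>cells. fps_of_poly (box_poly s \<xi> m \<Delta>))"
    proof (rule sum.cong)
      fix \<Delta> assume D: "\<Delta> \<in> cells"
      have "(\<Prod>v\<in>vertices_of \<Delta>. 1 - fps_X ^ (m v * d v)) = (\<Prod>v\<in>vertices_of \<Delta>. 1 - fps_X ^ N :: complex fps)"
        by (rule prod.cong) (use md[OF D] in auto)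
      also have "\<dots> = (1 - fps_X ^ N) ^ n" using card_cell[OF D] DIM_eq by simp
      finally show "level_series D (sector s \<xi> \<Delta>) * (1 - fps_X ^ N) ^ n = fps_of_poly (box_poly s \<xi> m \<Delta>)"
        using sector_series[OF D s gen[OF D], where m = m] fps_of_box_poly[OF D s, of \<xi> m] by simp
    qed simp
    also have "\<dots> = fps_of_poly (S s)" by (simp add: S_def fps_of_poly_sum)
    finally show ?thesis .
  qed
  \<comment> \<open>Both polynomials are the same series times the same denominator.\<close>
  have "fps_of_poly (S 1) = fps_of_poly (S (- 1))" using S[of 1] S[of "- 1"] by simp
  then have S_eq: "S (- 1) = S 1" by simp
  show ?thesis
  proof (intro exI[of _ N] exI[of _ "S 1"] conjI allI impI N S)
    show "degree (S 1) \<le> n * N"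
      unfolding S_def
    proof (rule degree_sum_le[OF finite_cells])
      fix \<Delta> assume "\<Delta> \<in> cells"
      then show "degree (box_poly 1 \<xi> m \<Delta>) \<le> n * N" using degree_box_poly[of 1 \<xi> m \<Delta>] E by simp
    qed
    fix k assume k: "k \<le> n * N"
    have "coeff (S (- 1)) k = coeff (S 1) (n * N - k)"
      unfolding S_def coeff_sum
    proof (rule sum.cong)
      fix \<Delta> assume D: "\<Delta> \<in> cells"
      show "coeff (box_poly (- 1) \<xi> m \<Delta>) k = coeff (box_poly 1 \<xi> m \<Delta>) (n * N - k)"
        using box_poly_reflect[OF D, of k m \<xi>] k unfolding E[OF D] by simp
    qed simp
    then show "coeff (S 1) (n * N - k) = coeff (S 1) k" unfolding S_eq by simp
  qed simp
qed

lemma ball_count_eq_sum: "ball_count \<Gamma> x0 i = (\<Sum>j\<le>i. sphere_count \<Gamma> x0 j)"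
proof -
  have "{y \<in> VV. gdist \<Gamma> x0 y \<le> enat i} = (\<Union>j\<le>i. {y \<in> VV. D y = j})"
    using x0 by (auto simp: gdist_eq_dn D_def)
  moreover have "card (\<Union>j\<le>i. {y \<in> VV. D y = j}) = (\<Sum>j\<le>i. card {y \<in> VV. D y = j})"
    by (rule card_UN_disjoint) (auto simp: finite_level)
  moreover have "{y \<in> VV. D y = j} = {y \<in> VV. gdist \<Gamma> x0 y = enat j}" for j
    using x0 by (auto simp: gdist_eq_dn D_def)
  ultimately show ?thesis by (simp add: ball_count_def sphere_count_def)
qed

end

theorem theorem5p7:
  fixes \<Gamma> :: "('v, 'e, 'a::euclidean_space) pgraph"
    and n :: nat
    and \<Phi> :: "'v \<Rightarrow> 'a"
    and x0 :: 'v
    and d :: "'a \<Rightarrow> nat"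
    and T :: "'a set \<Rightarrow> 'a set set"
  assumes "periodic_graph n \<Gamma>"
    and "undirected \<Gamma>"
    and "strongly_conn \<Gamma>"
    and "periodic_realization \<Gamma> \<Phi>"
    and "x0 \<in> verts (graph \<Gamma>)"
    and "well_arranged_by \<Gamma> \<Phi> x0 d T"
  shows "quasi_polynomial_on_ge 0 (ball_count \<Gamma> x0)
    \<and> (\<exists>Q1 Q2 :: complex poly.
         Q2 = growth_denominator \<Gamma> d T \<and> Q2 \<noteq> 0 \<and>
         gen_series (sphere_count \<Gamma> x0) * fps_of_poly Q2 = fps_of_poly Q1 \<and>
         degree Q1 \<le> degree Q2)
    \<and> (\<exists>Gb Gs :: complex poly fract.
         has_power_series Gb (gen_series (ball_count \<Gamma> x0)) \<and>
         has_power_series Gs (gen_series (sphere_count \<Gamma> x0)) \<and>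
         ratfun_subst Gb (1 / ratfun_var) = (- 1) ^ (n + 1) * ratfun_var * Gb \<and>
         ratfun_subst Gs (1 / ratfun_var) = (- 1) ^ n * Gs)
    \<and> (\<forall>fb. corresponding_quasi_polynomial (ball_count \<Gamma> x0) fb \<longrightarrow>
         (\<forall>i::int. fb (- i) = (- 1) ^ n * fb (i - 1)))
    \<and> (\<forall>fs. corresponding_quasi_polynomial (sphere_count \<Gamma> x0) fs \<longrightarrow>
         (\<forall>i::int. i \<noteq> 0 \<longrightarrow> fs (- i) = (- 1) ^ (n + 1) * fs i))"
proof -
  interpret well_arranged \<Gamma> n \<Phi> x0 d T
    by unfold_locales (use assms in auto)
  obtain N and S :: "complex poly" where NS: "N \<ge> 1" "degree S \<le> n * N"
    "\<forall>k\<le>n * N. coeff S (n * N - k) = coeff S k"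
    "gen_series (sphere_count \<Gamma> x0) * fps_of_poly ((1 - monom 1 N) ^ n) = fps_of_poly S"
    using palindromic_numerator by blast
  show ?thesis
    by (intro conjI growth_series_consequences[OF NS(1,2) NS(3)[rule_format] NS(4) ball_count_eq_sum] growth_series_rational)
qed

end
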